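(* Let $n\ge 3$ be an odd integer. There exists $\lambda_3>\sqrt{3}$ such that $Z_{\lambda_3}h_n(\tfrac16,0)=0$ and $$\left(\tfrac{\lambda_3}{3},\tfrac{1}{\lambda_3}\right)\notin\mathscr{F}(h_n),\qquad \left(\tfrac{1}{\lambda_3},\tfrac{\lambda_3}{3}\right)\notin\mathscr{F}(h_n).$$
   Context: For $n\in\mathbb{Z}_{\ge 0}$ the Hermite function is $h_n(x) = (-1)^n c_n^{-1/2} e^{\pi x^2}\frac{d^n}{dx^n}e^{-2\pi x^2}$, $x\in\mathbb{R}$, with $c_n=(2\pi)^n 2^{n-1/2} n!$. For $\lambda>0$ the Zak transform is $Z_\lambda f(x,\gamma)=\sqrt{\lambda}\sum_{k\in\mathbb{Z}}f(\lambda(x+k))e^{-2\pi i k\gamma}$, $x,\gamma\in\mathbb{R}$. For $g\in L^2(\mathbb{R})$ and $\alpha,\beta>0$, the Gabor system is $\mathcal{G}(g,\alpha,\beta)=\{e^{2\pi i\beta m\cdot}g(\cdot-\alpha k)\}_{k,m\in\mathbb{Z}}$. It is a frame for $L^2(\mathbb{R})$ if there are constants $A,B>0$ with $A\|f\|^2\le\sum_{k,m\in\mathbb{Z}}|\langle f,e^{2\pi i\beta m\cdot}g(\cdot-\alpha k)\rangle|^2\le B\|f\|^2$ for all $f\in L^2(\mathbb{R})$. The frame set $\mathscr{F}(g)$ is the set of $(\alpha,\beta)\in\mathbb{R}_{>0}^2$ for which $\mathcal{G}(g,\alpha,\beta)$ is a frame for $L^2(\mathbb{R})$. *)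

theory Defs
  imports "HOL-Analysis.Analysis"
begin

definition hermite_const :: "nat \<Rightarrow> real" where
  "hermite_const n = (2 * pi) ^ n * 2 powr (real n - 1/2) * fact n"

definition hermite_fun :: "nat \<Rightarrow> real \<Rightarrow> complex" where
  "hermite_fun n x = complex_of_real
     ((-1) ^ n * hermite_const n powr (-1/2) * exp (pi * x\<^sup>2)
       * (deriv ^^ n) (\<lambda>t. exp (- 2 * pi * t\<^sup>2)) x)"

(* infsum is 0 for a non-summable family; for rapidly decaying f, such as the Hermite
   functions, the series converges absolutely and this is its actual sum. *)
definition zak :: "real \<Rightarrow> (real \<Rightarrow> complex) \<Rightarrow> real \<Rightarrow> real \<Rightarrow> complex" where
  "zak l f x \<gamma> = complex_of_real (sqrt l) *
     (\<Sum>\<^sub>\<infinity>k\<in>(UNIV :: int set). f (l * (x + of_int k)) * cis (- 2 * pi * of_int k * \<gamma>))"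

(* L2 classes are represented by Borel functions: every class of Lebesgue measurable
   functions contains one, and nothing below depends on the representative. *)
definition in_L2 :: "(real \<Rightarrow> complex) \<Rightarrow> bool" where
  "in_L2 f \<longleftrightarrow> f \<in> borel_measurable lborel \<and> integrable lborel (\<lambda>x. (cmod (f x))\<^sup>2)"

definition L2_inner :: "(real \<Rightarrow> complex) \<Rightarrow> (real \<Rightarrow> complex) \<Rightarrow> complex" where
  "L2_inner f g = (\<integral>x. f x * cnj (g x) \<partial>lborel)"

definition L2_norm :: "(real \<Rightarrow> complex) \<Rightarrow> real" where
  "L2_norm f = sqrt (\<integral>x. (cmod (f x))\<^sup>2 \<partial>lborel)"

definition gabor_atom ::
  "(real \<Rightarrow> complex) \<Rightarrow> real \<Rightarrow> real \<Rightarrow> int \<times> int \<Rightarrow> real \<Rightarrow> complex" where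
  "gabor_atom g \<alpha> \<beta> = (\<lambda>(k, m) x. cis (2 * pi * \<beta> * of_int m * x) * g (x - \<alpha> * of_int k))"

(* Summability is demanded explicitly because infsum of a divergent family is 0; for these
   nonnegative terms it says that the sum is finite, which the upper bound entails. *)
definition is_L2_frame :: "('i \<Rightarrow> real \<Rightarrow> complex) \<Rightarrow> bool" where
  "is_L2_frame e \<longleftrightarrow> (\<exists>A>0. \<exists>B>0. \<forall>f. in_L2 f \<longrightarrow>
     (\<lambda>i. (cmod (L2_inner f (e i)))\<^sup>2) summable_on UNIV \<and>
     A * (L2_norm f)\<^sup>2 \<le> (\<Sum>\<^sub>\<infinity>i. (cmod (L2_inner f (e i)))\<^sup>2) \<and>
     (\<Sum>\<^sub>\<infinity>i. (cmod (L2_inner f (e i)))\<^sup>2) \<le> B * (L2_norm f)\<^sup>2)"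

(* Intended for windows g in L2. *)
definition frame_set :: "(real \<Rightarrow> complex) \<Rightarrow> (real \<times> real) set" where
  "frame_set g = {(\<alpha>, \<beta>). \<alpha> > 0 \<and> \<beta> > 0 \<and> is_L2_frame (gabor_atom g \<alpha> \<beta>)}"

end

theory Submission
  imports Defs "HOL-Probability.Probability"
begin

text \<open>
  Both failures of the frame property come from a common zero of several Zak transforms. At the
  density \<open>\<alpha>\<beta> = 1/3\<close> with \<open>\<alpha> = \<lambda>/3\<close> and \<open>\<beta> = 1/\<lambda>\<close>, the sum of
  squared frame coefficients is controlled by the three values \<open>Z g (x - j/3, \<gamma>)\<close>, \<open>j = 0, 1, 2\<close>,
  of the Zak transform of the window \<open>g\<close>; if they all vanish at one point \<open>(x, \<gamma>)\<close>, functions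
  concentrated near the points \<open>\<lambda> (x + k)\<close> and modulated by \<open>\<gamma>\<close> break the lower frame bound
  (\<open>gabor_obstruction.not_frame\<close>). Only Bessel's inequality is needed for this direction.

  The point is \<open>(1/6, 0)\<close>. For an odd window the value at \<open>1/6 - 2/3 = -1/2\<close> vanishes by symmetry and
  the value at \<open>1/6 - 1/3 = -1/6\<close> is minus the one at \<open>1/6\<close>, so a single equation in \<open>\<lambda>\<close> remains:
  \<open>F \<lambda> = (\<Sum>k. h (\<lambda> (k + 1/6))) = 0\<close>. It is solved by the intermediate value theorem
  (\<open>hermite_lattice_sum_zero\<close>). Oddness turns \<open>F\<close> into the alternating series
  \<open>h (\<lambda>/6) - h (5\<lambda>/6) + h (7\<lambda>/6) - \<dots>\<close>, and \<open>h\<close> is positive and strictly decreasing beyond its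
  turning point \<open>T\<close>. Hence \<open>F (6 T) > 0\<close>, while \<open>F (6 x) < 0\<close> as soon as \<open>h x \<le> 0\<close> and \<open>5 x \<ge> T\<close>. For
  \<open>n = 3\<close> such an \<open>x\<close> is the positive zero of \<open>h\<close>; for larger \<open>n\<close> Sturm comparison with a sine wave
  provides it. In both cases \<open>x > \<surd>3/6\<close>, which gives \<open>\<lambda> > \<surd>3\<close>.

  For the pair \<open>(1/\<lambda>, \<lambda>/3)\<close> the same obstruction is applied with \<open>3/\<lambda>\<close> in place of \<open>\<lambda>\<close>, at the
  point \<open>(0, 1/2)\<close>. The Hermite function is an eigenfunction of the Fourier transform, so Poisson
  summation (\<open>poisson_fun.poisson\<close>) turns \<open>F \<lambda> = 0\<close> into \<open>(\<Sum>m. exp (\<pi> \<i> m / 3) h (m/\<lambda>)) = 0\<close>.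
  Sorting \<open>m\<close> by its residue modulo 3 gives three series of the form needed: one vanishes by oddness,
  the other two are equal and occur with coefficients whose sum does not vanish
  (\<open>odd_window_not_frame_dual\<close>).
\<close>

section \<open>Polynomials times a Gaussian and Hermite functions\<close>

definition poly_gauss :: "real poly \<Rightarrow> real \<Rightarrow> real" where
  "poly_gauss p x = poly p x * exp (- pi * x\<^sup>2)"

lemma poly_gauss_has_deriv [derivative_intros]:
  "(poly_gauss p has_real_derivative poly_gauss (pderiv p - [:0, 2 * pi:] * p) x) (at x)"
  unfolding poly_gauss_def [abs_def]
  by (rule derivative_eq_intros refl poly_DERIV | simp add: algebra_simps)+

lemma poly_gauss_diff: "poly_gauss (p - q) x = poly_gauss p x - poly_gauss q x"
  and poly_gauss_smult: "poly_gauss (smult c p) x = c * poly_gauss p x"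
  and poly_gauss_mult: "poly_gauss (r * p) x = poly r x * poly_gauss p x"
  by (simp_all add: poly_gauss_def algebra_simps)

lemma continuous_on_poly_gauss [continuous_intros]:
  "continuous_on S f \<Longrightarrow> continuous_on S (\<lambda>x. poly_gauss p (f x))"
  unfolding poly_gauss_def by (intro continuous_intros)

lemma power_gauss_le: "\<bar>x\<bar> ^ k * exp (- pi * x\<^sup>2) \<le> fact k * exp (1::real)"
proof -
  have "(\<Sum>n\<in>{k}. \<bar>x\<bar> ^ n /\<^sub>R fact n) \<le> (\<Sum>n. \<bar>x\<bar> ^ n /\<^sub>R fact n)"
    by (intro sum_le_suminf summable_exp_generic) auto
  then have "\<bar>x\<bar> ^ k \<le> fact k * exp \<bar>x\<bar>"
    by (simp add: exp_def field_simps)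
  then have "\<bar>x\<bar> ^ k * exp (- pi * x\<^sup>2) \<le> fact k * (exp \<bar>x\<bar> * exp (- pi * x\<^sup>2))"
    by (simp add: mult_right_mono flip: mult.assoc)
  also have "exp \<bar>x\<bar> * exp (- pi * x\<^sup>2) = exp (\<bar>x\<bar> - pi * x\<^sup>2)"
    by (simp flip: exp_add)
  also have "\<dots> \<le> exp 1"
  proof -
    have "\<bar>x\<bar> \<le> 1 + x\<^sup>2"
      using sum_power2_ge_zero[of "\<bar>x\<bar> - 1/2" 0] by (simp add: power2_eq_square algebra_simps)
    moreover have "x\<^sup>2 \<le> pi * x\<^sup>2" using pi_gt3 by (simp add: mult_le_cancel_right1)
    ultimately show ?thesis by simp
  qed
  finally show ?thesis by simp
qed

lemma poly_gauss_bounded: "\<exists>C. \<forall>x. \<bar>poly_gauss p x\<bar> \<le> C"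
proof (intro exI allI)
  fix x
  have "\<bar>poly_gauss p x\<bar> \<le> (\<Sum>i\<le>degree p. \<bar>coeff p i\<bar> * (\<bar>x\<bar> ^ i * exp (- pi * x\<^sup>2)))"
    unfolding poly_gauss_def poly_altdef sum_distrib_right
    by (rule order.trans[OF sum_abs]) (simp add: abs_mult power_abs mult.assoc)
  also have "\<dots> \<le> (\<Sum>i\<le>degree p. \<bar>coeff p i\<bar> * (fact i * exp 1))"
    by (intro sum_mono mult_left_mono power_gauss_le) simp
  finally show "\<bar>poly_gauss p x\<bar> \<le> (\<Sum>i\<le>degree p. \<bar>coeff p i\<bar> * (fact i * exp 1))" .
qed

text \<open>Multiplying \<open>p\<close> by a further polynomial stays within the class, so boundedness alone gives any polynomial rate of decay.\<close>

lemma poly_gauss_decay: "\<exists>C>0. \<forall>x. \<bar>poly_gauss p x\<bar> * (1 + x\<^sup>2) ^ 2 \<le> C"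
proof -
  obtain C where C: "\<And>x. \<bar>poly_gauss ([:1, 0, 1:] ^ 2 * p) x\<bar> \<le> C"
    using poly_gauss_bounded by blast
  have "\<bar>poly_gauss p x\<bar> * (1 + x\<^sup>2) ^ 2 \<le> max C 1" for x
  proof -
    have "\<bar>poly_gauss p x\<bar> * (1 + x\<^sup>2) ^ 2 = \<bar>poly_gauss ([:1, 0, 1:] ^ 2 * p) x\<bar>"
      unfolding poly_gauss_mult abs_mult poly_power by (simp add: power2_eq_square)
    then show ?thesis using C[of x] by simp
  qed
  then show ?thesis by (intro exI[of _ "max C 1"]) auto
qed

text \<open>In terms of the classical Hermite polynomials this is \<open>(2\<pi>)\<^sup>n\<^sup>/\<^sup>2 H\<^sub>n (\<surd>(2\<pi>) x)\<close>; the scaling is the one for which the recursion produces the derivatives of \<open>exp (- 2 \<pi> x\<^sup>2)\<close>, and for which \<open>hermite_gauss\<close> below is invariant under the Fourier transform up to a constant.\<close>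

fun hermite_poly :: "nat \<Rightarrow> real poly" where
  "hermite_poly 0 = 1"
| "hermite_poly (Suc n) = [:0, 4 * pi:] * hermite_poly n - pderiv (hermite_poly n)"

abbreviation "hermite_gauss n \<equiv> poly_gauss (hermite_poly n)"

lemma deriv_iter_gauss:
  "(deriv ^^ n) (\<lambda>t. exp (- 2 * pi * t\<^sup>2)) =
     (\<lambda>x::real. (-1) ^ n * poly (hermite_poly n) x * exp (- 2 * pi * x\<^sup>2))"
proof (induction n)
  case (Suc n)
  show ?case
    unfolding funpow.simps o_def Suc.IH
    by (rule ext, rule DERIV_imp_deriv)
       (rule derivative_eq_intros refl poly_DERIV | simp add: algebra_simps)+
qed simp

lemma hermite_fun_eq:
  "hermite_fun n x = complex_of_real (hermite_const n powr (-1/2) * hermite_gauss n x)"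
proof -
  have "exp (pi * x\<^sup>2) * exp (- 2 * pi * x\<^sup>2) = exp (- pi * x\<^sup>2)"
    by (simp flip: exp_add)
  moreover have "(-1::real) ^ n * (-1) ^ n = 1"
    by (simp flip: power_mult_distrib)
  ultimately show ?thesis
    unfolding hermite_fun_def deriv_iter_gauss poly_gauss_def
    by (simp del: of_real_mult of_real_power add: mult_ac)
qed

text \<open>The lowering relation: together with the raising recursion it yields both the differential equation and the three-term recursion used for the Fourier transform.\<close>

lemma pderiv_hermite_poly: "pderiv (hermite_poly (Suc n)) = smult (4 * pi * (real n + 1)) (hermite_poly n)"
proof (induction n)
  case 0 show ?case by (simp add: pderiv_pCons)
next
  case (Suc n)
  have "pderiv (hermite_poly (Suc (Suc n))) =
     smult (4 * pi) (hermite_poly (Suc n)) + [:0, 4 * pi:] * pderiv (hermite_poly (Suc n))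
       - pderiv (pderiv (hermite_poly (Suc n)))"
    unfolding hermite_poly.simps(2)[of "Suc n"] pderiv_diff pderiv_mult by (simp add: pderiv_pCons)
  also have "\<dots> = smult (4 * pi) (hermite_poly (Suc n)) + smult (4 * pi * (real n + 1))
        ([:0, 4 * pi:] * hermite_poly n - pderiv (hermite_poly n))"
    unfolding Suc.IH pderiv_smult by (simp add: algebra_simps smult_diff_right)
  also have "[:0, 4 * pi:] * hermite_poly n - pderiv (hermite_poly n) = hermite_poly (Suc n)" by simp
  finally show ?case by (simp add: algebra_simps flip: smult_add_left del: hermite_poly.simps)
qed

lemma hermite_poly_reflect: "hermite_poly n \<circ>\<^sub>p [:0, -1:] = smult ((-1) ^ n) (hermite_poly n)"
proof (induction n)
  case (Suc n)
  have "pderiv (hermite_poly n \<circ>\<^sub>p [:0, -1:]) = - (pderiv (hermite_poly n) \<circ>\<^sub>p [:0, -1:])"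
    by (simp add: pderiv_pcompose pderiv_pCons)
  then have "pderiv (hermite_poly n) \<circ>\<^sub>p [:0, -1:] = smult ((-1) ^ Suc n) (pderiv (hermite_poly n))"
    by (simp only: Suc.IH pderiv_smult) simp
  then show ?case
    by (simp add: pcompose_diff pcompose_mult pcompose_smult Suc.IH pcompose_pCons smult_diff_right mult.commute)
qed (simp add: pcompose_1)

lemma hermite_gauss_uminus: "hermite_gauss n (- x) = (-1) ^ n * hermite_gauss n x"
proof -
  have "poly (hermite_poly n) (- x) = poly (hermite_poly n \<circ>\<^sub>p [:0, -1:]) x"
    by (simp add: poly_pcompose)
  then show ?thesis by (simp add: hermite_poly_reflect poly_gauss_def)
qed

lemma hermite_lead: "degree (hermite_poly n) = n \<and> coeff (hermite_poly n) n = (4 * pi) ^ n"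
proof (induction n)
  case (Suc n)
  have nz: "hermite_poly n \<noteq> 0" using Suc by auto
  have d: "degree ([:0, 4 * pi:] * hermite_poly n) = Suc n" using Suc nz by (subst degree_mult_eq) auto
  moreover have "degree (pderiv (hermite_poly n)) < Suc n" using Suc by (simp add: degree_pderiv)
  ultimately have "degree (hermite_poly (Suc n)) = Suc n"
    unfolding hermite_poly.simps by (subst diff_conv_add_uminus, subst degree_add_eq_left) auto
  moreover have "coeff (hermite_poly (Suc n)) (Suc n) = (4 * pi) ^ Suc n"
    using Suc by (simp add: coeff_pderiv coeff_eq_0)
  ultimately show ?case by blast
qed simp


lemma hermite_poly_ode:
  "pderiv (pderiv (hermite_poly n)) = [:0, 4 * pi:] * pderiv (hermite_poly n) - smult (4 * pi * n) (hermite_poly n)"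
proof (cases n)
  case (Suc m)
  have "hermite_poly n = [:0, 4 * pi:] * hermite_poly m - pderiv (hermite_poly m)" by (simp add: Suc)
  then show ?thesis
    unfolding Suc pderiv_hermite_poly pderiv_smult
    by (simp add: algebra_simps smult_diff_right smult_add_right)
qed simp

definition hermite_gauss' :: "nat \<Rightarrow> real \<Rightarrow> real" where
  "hermite_gauss' n = poly_gauss (pderiv (hermite_poly n) - [:0, 2 * pi:] * hermite_poly n)"

lemma hermite_gauss_has_deriv:
  "(hermite_gauss n has_real_derivative hermite_gauss' n x) (at x)"
  unfolding hermite_gauss'_def by (rule poly_gauss_has_deriv)

lemma hermite_gauss'_has_deriv:
  "(hermite_gauss' n has_real_derivative
     (4 * pi\<^sup>2 * x\<^sup>2 - 2 * pi * (2 * n + 1)) * hermite_gauss n x) (at x)"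
proof -
  have "pderiv (pderiv (hermite_poly n) - [:0, 2 * pi:] * hermite_poly n) -
      [:0, 2 * pi:] * (pderiv (hermite_poly n) - [:0, 2 * pi:] * hermite_poly n)
      = [:- 2 * pi * (2 * n + 1), 0, 4 * pi\<^sup>2:] * hermite_poly n"
    unfolding pderiv_diff pderiv_mult hermite_poly_ode
    by (rule poly_ext) (simp add: pderiv_pCons algebra_simps power2_eq_square)
  then have "poly_gauss (pderiv (pderiv (hermite_poly n) - [:0, 2 * pi:] * hermite_poly n) -
      [:0, 2 * pi:] * (pderiv (hermite_poly n) - [:0, 2 * pi:] * hermite_poly n)) x
      = (4 * pi\<^sup>2 * x\<^sup>2 - 2 * pi * (2 * n + 1)) * hermite_gauss n x"
    by (simp only: poly_gauss_mult) (simp add: algebra_simps power2_eq_square)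
  with poly_gauss_has_deriv[of "pderiv (hermite_poly n) - [:0, 2 * pi:] * hermite_poly n" x]
  show ?thesis by (simp only: hermite_gauss'_def)
qed

lemma poly_gauss_tendsto_0: "(poly_gauss p \<longlongrightarrow> 0) at_infinity"
proof -
  obtain C where C: "\<And>x. \<bar>poly_gauss p x\<bar> * (1 + x\<^sup>2) ^ 2 \<le> C" using poly_gauss_decay by blast
  have le: "norm (poly_gauss p x) \<le> \<bar>C\<bar> / \<bar>x\<bar>" if "x \<noteq> 0" for x
  proof -
    have "\<bar>x\<bar> \<le> 1 + x\<^sup>2"
      using sum_power2_ge_zero[of "\<bar>x\<bar> - 1/2" 0] by (simp add: power2_eq_square algebra_simps)
    also have "\<dots> \<le> (1 + x\<^sup>2) ^ 2" by (intro self_le_power) auto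
    finally have "\<bar>poly_gauss p x\<bar> * \<bar>x\<bar> \<le> \<bar>poly_gauss p x\<bar> * (1 + x\<^sup>2) ^ 2" by (intro mult_left_mono) auto
    also have "\<dots> \<le> \<bar>C\<bar>" using C[of x] by linarith
    finally show ?thesis using that by (simp add: field_simps)
  qed
  have lim: "((\<lambda>x::real. \<bar>C\<bar> / \<bar>x\<bar>) \<longlongrightarrow> 0) at_infinity"
    using filterlim_norm_at_top[where 'a=real]
    by (intro tendsto_divide_0[OF tendsto_const] filterlim_at_top_imp_at_infinity)
       (simp flip: real_norm_def)
  have "\<forall>\<^sub>F x::real in at_infinity. x \<noteq> 0"
    unfolding eventually_at_infinity by (rule exI[of _ 1]) auto
  then have "\<forall>\<^sub>F x in at_infinity. norm (poly_gauss p x) \<le> \<bar>C\<bar> / \<bar>x\<bar>"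
    by (rule eventually_mono) (rule le)
  then show ?thesis using lim by (rule Lim_null_comparison)
qed

lemma poly_gauss_at_top: "(poly_gauss p \<longlongrightarrow> 0) at_top"
  by (rule tendsto_mono[OF at_top_le_at_infinity poly_gauss_tendsto_0])

lemma poly_gauss_at_bot: "(poly_gauss p \<longlongrightarrow> 0) at_bot"
  by (rule tendsto_mono[OF at_bot_le_at_infinity poly_gauss_tendsto_0])

section \<open>Sign and monotonicity of Hermite functions\<close>

text \<open>The classical turning point of the oscillator: here the coefficient \<open>4 \<pi>\<^sup>2 (x\<^sup>2 - T\<^sup>2)\<close> in the differential equation of \<open>hermite_gauss\<close> changes sign, see \<open>hermite_gauss_ode\<close>.\<close>

definition turning_point :: "nat \<Rightarrow> real" where
  "turning_point n = sqrt ((2 * real n + 1) / (2 * pi))"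

lemma turning_point_pos: "turning_point n > 0"
  by (simp add: turning_point_def)

lemma turning_point_sq: "2 * pi * (2 * real n + 1) = 4 * pi\<^sup>2 * (turning_point n)\<^sup>2"
  by (simp add: turning_point_def field_simps power2_eq_square)

lemma hermite_gauss_eventually_pos: "\<exists>X. \<forall>x\<ge>X. hermite_gauss n x > 0"
proof -
  have lc: "lead_coeff (hermite_poly n) > 0" using hermite_lead[of n] by simp
  then obtain X where "\<forall>x\<ge>X. poly (hermite_poly n) x \<ge> lead_coeff (hermite_poly n)"
    using poly_pinfty_gt_lc by blast
  then have "\<forall>x\<ge>X. poly (hermite_poly n) x > 0" using lc by force
  then have "\<forall>x\<ge>X. hermite_gauss n x > 0" by (simp add: poly_gauss_def)
  then show ?thesis by blast
qed

lemma hermite_gauss_ode: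
  "(hermite_gauss' n has_real_derivative
     4 * pi\<^sup>2 * (x\<^sup>2 - (turning_point n)\<^sup>2) * hermite_gauss n x) (at x)"
proof -
  have "4 * pi\<^sup>2 * x\<^sup>2 - 2 * pi * (2 * n + 1) = 4 * pi\<^sup>2 * (x\<^sup>2 - (turning_point n)\<^sup>2)"
    using turning_point_sq[of n] by (simp add: right_diff_distrib add.commute)
  with hermite_gauss'_has_deriv[of n x] show ?thesis by (simp only:)
qed

text \<open>Beyond the turning point \<open>(u u')' = u'\<^sup>2 + q u\<^sup>2\<close> is nonnegative, \<open>q\<close> being the coefficient in \<open>hermite_gauss_ode\<close>, so \<open>u u'\<close> increases towards its limit 0. If it reached 0 at a finite point it would vanish from there on, and so would \<open>u\<close>, which contradicts the positive leading coefficient of the polynomial.\<close>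

lemma hermite_gauss_mult_deriv_neg:
  assumes "x \<ge> turning_point n"
  shows "hermite_gauss n x * hermite_gauss' n x < 0"
proof (rule ccontr)
  define u where "u = hermite_gauss n"
  define u' where "u' = hermite_gauss' n"
  define q where "q y = 4 * pi\<^sup>2 * (y\<^sup>2 - (turning_point n)\<^sup>2)" for y
  define w where "w y = u y * u' y" for y
  define w' where "w' y = (u' y)\<^sup>2 + q y * (u y)\<^sup>2" for y
  assume "\<not> ?thesis"
  then have wx: "w x \<ge> 0" by (simp add: w_def u_def u'_def)
  have w': "(w has_real_derivative w' y) (at y)" for y
    unfolding w_def [abs_def] w'_def u_def u'_def q_def
    by (rule derivative_eq_intros hermite_gauss_has_deriv hermite_gauss_ode refl
        | simp add: algebra_simps power2_eq_square)+
  have q: "q y > 0" if "y > x" for y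
  proof -
    have "(turning_point n)\<^sup>2 < y\<^sup>2"
      using that assms turning_point_pos[of n] by (intro power_strict_mono) auto
    then show ?thesis
      unfolding q_def by simp
  qed
  have mono: "w y \<le> w z" if "x \<le> y" "y \<le> z" for y z
  proof (rule DERIV_nonneg_imp_increasing_open[OF that(2)])
    show "\<exists>d. (w has_real_derivative d) (at t) \<and> d \<ge> 0" if "y < t" "t < z" for t
      using w'[of t] q[of t] that \<open>x \<le> y\<close> by (intro exI[of _ "w' t"]) (auto simp: w'_def)
    show "continuous_on {y..z} w"
      using w' by (meson DERIV_continuous_on has_field_derivative_at_within)
  qed
  have lim: "(w \<longlongrightarrow> 0) at_top"
    unfolding w_def u_def u'_def hermite_gauss'_def
    by (rule tendsto_mult_zero; rule poly_gauss_at_top)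
  have le0: "w y \<le> 0" if "y \<ge> x" for y
  proof (rule tendsto_lowerbound[OF lim])
    show "\<forall>\<^sub>F z in at_top. w y \<le> w z"
      using eventually_ge_at_top[of y] by eventually_elim (use mono that in auto)
  qed simp
  have w0: "w y = 0" if "y \<ge> x" for y
    using mono[of x y] le0[of y] wx that by simp
  have "u y = 0" if "y > x" for y
  proof -
    have "((\<lambda>_. 0) has_real_derivative w' y) (at y)"
      by (rule has_field_derivative_transform_within_open[OF w'[of y], of "{x<..}"]) (use that w0 in auto)
    then have "w' y = 0" using DERIV_unique DERIV_const by blast
    moreover have "(u' y)\<^sup>2 \<ge> 0" "q y * (u y)\<^sup>2 \<ge> 0" using q[OF that] by auto
    ultimately have "q y * (u y)\<^sup>2 = 0" unfolding w'_def by linarith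
    then show ?thesis using q[OF that] by simp
  qed
  then have "u (max X (x + 1)) = 0" for X by simp
  moreover obtain X where "\<And>y. y \<ge> X \<Longrightarrow> u y > 0" using hermite_gauss_eventually_pos u_def by blast
  then have "u (max X (x + 1)) > 0" by simp
  ultimately show False by simp
qed

lemma hermite_gauss_pos:
  assumes "x \<ge> turning_point n"
  shows "hermite_gauss n x > 0"
proof (rule ccontr)
  assume "\<not> ?thesis"
  then have le: "hermite_gauss n x \<le> 0" by simp
  obtain X where X: "\<And>y. y \<ge> X \<Longrightarrow> hermite_gauss n y > 0" using hermite_gauss_eventually_pos by blast
  have "\<exists>y\<ge>x. y \<le> max x X \<and> hermite_gauss n y = 0"
  proof (rule IVT'[of "hermite_gauss n" x 0 "max x X"])
    show "hermite_gauss n x \<le> 0" by (rule le)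
    show "0 \<le> hermite_gauss n (max x X)" using X[of "max x X"] by (simp add: less_imp_le)
    show "continuous_on {x..max x X} (hermite_gauss n)"
      by (intro continuous_on_poly_gauss continuous_on_id)
  qed simp
  then obtain y where "y \<ge> x" "hermite_gauss n y = 0" by blast
  then show False using hermite_gauss_mult_deriv_neg[of n y] assms by simp
qed

lemma hermite_gauss_decreasing:
  assumes "turning_point n \<le> x" "x < y"
  shows "hermite_gauss n y < hermite_gauss n x"
proof (rule DERIV_neg_imp_decreasing[OF assms(2)])
  fix t assume t: "x \<le> t" "t \<le> y"
  then have "hermite_gauss' n t < 0"
    using hermite_gauss_mult_deriv_neg[of n t] hermite_gauss_pos[of n t] assms
    by (auto simp: mult_less_0_iff)
  then show "\<exists>d. (hermite_gauss n has_real_derivative d) (at t) \<and> d < 0"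
    using hermite_gauss_has_deriv by blast
qed

text \<open>Sturm comparison with \<open>s x = sin (\<omega> (x - a))\<close>: as long as \<open>u > 0\<close>, the Wronskian \<open>u' s - u s'\<close> is nonincreasing on the half period \<open>[a, a + \<pi>/\<omega>]\<close>, although its boundary values \<open>- \<omega> u a\<close> and \<open>\<omega> u (a + \<pi>/\<omega>)\<close> would force it to increase.\<close>

lemma sturm_sign_change:
  fixes u u' q :: "real \<Rightarrow> real" and a \<omega> :: real
  assumes "\<omega> > 0"
    and u: "\<And>x. (u has_real_derivative u' x) (at x)"
    and u': "\<And>x. (u' has_real_derivative - q x * u x) (at x)"
    and q: "\<And>x. a \<le> x \<Longrightarrow> x \<le> a + pi / \<omega> \<Longrightarrow> q x \<ge> \<omega>\<^sup>2"
  shows "\<exists>x. a \<le> x \<and> x \<le> a + pi / \<omega> \<and> u x \<le> 0"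
proof (rule ccontr)
  define b where "b = a + pi / \<omega>"
  have ab: "a < b" using assms by (simp add: b_def)
  assume "\<not> ?thesis"
  then have none: "\<not> u x \<le> 0" if "a \<le> x" "x \<le> b" for x using that unfolding b_def by blast
  then have pos: "u x > 0" if "a \<le> x" "x \<le> b" for x using that by force
  define W where "W x = u' x * sin (\<omega> * (x - a)) - \<omega> * u x * cos (\<omega> * (x - a))" for x
  have W': "(W has_real_derivative (\<omega>\<^sup>2 - q x) * (u x * sin (\<omega> * (x - a)))) (at x)" for x
    unfolding W_def [abs_def]
    by (rule derivative_eq_intros u u' refl | simp add: algebra_simps power2_eq_square)+
  have "W b \<le> W a"
  proof (rule DERIV_nonpos_imp_nonincreasing[of a b W])
    fix x assume x: "a \<le> x" "x \<le> b"
    then have "\<omega> * (x - a) \<le> pi" using \<open>\<omega> > 0\<close> by (simp add: b_def field_simps)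
    then have "sin (\<omega> * (x - a)) \<ge> 0" using x \<open>\<omega> > 0\<close> by (intro sin_ge_zero) auto
    moreover have "q x \<ge> \<omega>\<^sup>2" using q x by (simp add: b_def)
    ultimately have "(\<omega>\<^sup>2 - q x) * (u x * sin (\<omega> * (x - a))) \<le> 0"
      using pos[OF x] by (intro mult_nonpos_nonneg) auto
    then show "\<exists>d. (W has_real_derivative d) (at x) \<and> d \<le> 0" using W' by blast
  qed (use ab in simp)
  moreover have "W a = - \<omega> * u a" "W b = \<omega> * u b"
    using \<open>\<omega> > 0\<close> by (simp_all add: W_def b_def)
  moreover have "\<omega> * u a > 0" "\<omega> * u b > 0" using pos ab \<open>\<omega> > 0\<close> by auto
  ultimately show False by linarith
qed

text \<open>The lower bound \<open>\<surd>3/6\<close> becomes \<open>\<lambda> > \<surd>3\<close> under \<open>\<lambda> = 6 x\<close>. The bound \<open>T \<le> 5 x\<close> says that the second sampling point \<open>5\<lambda>/6\<close> of the lattice already lies in the region where the function decreases.\<close>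

lemma hermite_gauss_nonpos_point:
  assumes "n \<ge> 3" "odd n"
  shows "\<exists>x. x > sqrt 3 / 6 \<and> turning_point n \<le> 5 * x \<and> x < turning_point n \<and> hermite_gauss n x \<le> 0"
proof -
  have "\<exists>x. x\<^sup>2 > 3 / 36 \<and> x > 0 \<and> (turning_point n)\<^sup>2 \<le> 25 * x\<^sup>2 \<and> hermite_gauss n x \<le> 0"
  proof (cases "n = 3")
    case True
    define x where "x = sqrt (3 / (4 * pi))"
    have x2: "x\<^sup>2 = 3 / (4 * pi)" by (simp add: x_def)
    have "hermite_poly 3 = [:0, - 48 * pi\<^sup>2, 0, 64 * pi ^ 3:]"
      by (simp add: numeral_3_eq_3 pderiv_pCons power2_eq_square)
    then have "poly (hermite_poly 3) x = 16 * pi\<^sup>2 * x * (4 * pi * x\<^sup>2 - 3)"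
      by (simp add: algebra_simps power2_eq_square power3_eq_cube)
    then have "hermite_gauss n x = 0" by (simp add: True poly_gauss_def x2)
    moreover have "x\<^sup>2 > 3 / 36" unfolding x2 using pi_less_4 by (simp add: field_simps)
    moreover have "(turning_point n)\<^sup>2 \<le> 25 * x\<^sup>2" unfolding x2
      by (simp add: turning_point_def True field_simps)
    moreover have "x > 0" by (simp add: x_def)
    ultimately show ?thesis by (intro exI[of _ x]) auto
  next
    case False
    then have n5: "n \<ge> 5" using assms by (cases "n = 4") auto
    define T where "T = turning_point n"
    have T: "T > 0" using turning_point_pos T_def by simp
    have pi: "pi < 63/20" using pi_approx by simp
    have T2: "T\<^sup>2 = (2 * real n + 1) / (2 * pi)" by (simp add: T_def turning_point_def)
    have T2': "T\<^sup>2 \<ge> 110 / 63" unfolding T2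
      using n5 pi by (simp add: field_simps) 
    \<comment> \<open>The factor 9/40 exceeds both 1/5 and what \<open>a > \<surd>3/6\<close> requires when \<open>n \<ge> 5\<close>. On \<open>[a, 3T/5]\<close> the coefficient \<open>4\<pi>\<^sup>2 (T\<^sup>2 - x\<^sup>2)\<close> is at least \<open>\<omega>\<^sup>2\<close>, and the half period \<open>\<pi>/\<omega> = 5/(8T)\<close> fits into that interval because \<open>T\<^sup>2 \<ge> 5/3\<close>.\<close>
    define a where "a = 9/40 * T"
    define \<omega> where "\<omega> = 8/5 * pi * T"
    have "pi / \<omega> \<le> 3/8 * T" using T T2' by (simp add: \<omega>_def field_simps power2_eq_square)
    then have b: "a + pi / \<omega> \<le> 3/5 * T" by (simp add: a_def)
    have "\<exists>x. a \<le> x \<and> x \<le> a + pi / \<omega> \<and> hermite_gauss n x \<le> 0"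
    proof (rule sturm_sign_change[where u' = "hermite_gauss' n" and q = "\<lambda>x. 4 * pi\<^sup>2 * (T\<^sup>2 - x\<^sup>2)"])
      show "\<omega> > 0" using T by (simp add: \<omega>_def)
      show "(hermite_gauss n has_real_derivative hermite_gauss' n x) (at x)" for x
        by (rule hermite_gauss_has_deriv)
      show "(hermite_gauss' n has_real_derivative - (4 * pi\<^sup>2 * (T\<^sup>2 - x\<^sup>2)) * hermite_gauss n x) (at x)" for x
        using hermite_gauss_ode[of n x] unfolding T_def
        by (simp add: right_diff_distrib left_diff_distrib)
      show "4 * pi\<^sup>2 * (T\<^sup>2 - x\<^sup>2) \<ge> \<omega>\<^sup>2" if "a \<le> x" "x \<le> a + pi / \<omega>" for x
      proof -
        have "x\<^sup>2 \<le> (3/5 * T)\<^sup>2" using that b T by (intro power_mono) (auto simp: a_def)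
        then have "4 * pi\<^sup>2 * (16/25 * T\<^sup>2) \<le> 4 * pi\<^sup>2 * (T\<^sup>2 - x\<^sup>2)"
          by (intro mult_left_mono) (auto simp: power_mult_distrib power_divide)
        then show ?thesis by (simp add: \<omega>_def power_mult_distrib power_divide)
      qed
    qed
    then obtain x where x: "a \<le> x" "hermite_gauss n x \<le> 0" by blast
    have x2: "x\<^sup>2 \<ge> 81/1600 * T\<^sup>2"
      using power_mono[OF x(1), of 2] T by (simp add: a_def power_mult_distrib power_divide)
    show ?thesis
      using x x2 T2' T by (intro exI[of _ x]) (auto simp: a_def T_def[symmetric])
  qed
  then obtain x where x: "x\<^sup>2 > 3 / 36" "x > 0" "(turning_point n)\<^sup>2 \<le> 25 * x\<^sup>2" "hermite_gauss n x \<le> 0"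
    by blast
  have "(sqrt 3 / 6)\<^sup>2 < x\<^sup>2" using x by (simp add: power_divide)
  then have "sqrt 3 / 6 < x" by (rule power2_less_imp_less) (use x(2) in simp)
  moreover have "turning_point n \<le> 5 * x"
    by (rule power2_le_imp_le) (use x(2,3) in \<open>simp_all add: power_mult_distrib\<close>)
  moreover have "x < turning_point n"
    using x(4) hermite_gauss_pos[of n x] by (meson linorder_not_le)
  ultimately show ?thesis using x(4) by blast
qed

section \<open>Lattice sums of odd functions\<close>

lemma one_plus_square [simp]: "0 < 1 + (x::real)\<^sup>2" "1 + (x::real)\<^sup>2 \<noteq> 0" "\<not> 1 + (x::real)\<^sup>2 < 0"
  by (simp_all add: add_pos_nonneg add_nonneg_eq_0_iff not_less)


text \<open>The exponent leaves room for one extra factor \<open>\<bar>p\<bar>\<close> in the lattice sums of the frame estimate.\<close>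

definition decays :: "(real \<Rightarrow> 'a :: real_normed_vector) \<Rightarrow> real \<Rightarrow> bool" where
  "decays f C \<longleftrightarrow> (\<forall>x. norm (f x) * (1 + x\<^sup>2) ^ 2 \<le> C)"

lemma decays_nonneg: "decays f C \<Longrightarrow> C \<ge> 0"
  unfolding decays_def by (meson norm_ge_zero order_trans zero_le_mult_iff zero_le_power2)

lemma decays_le:
  assumes "decays f C"
  shows "norm (f x) \<le> C"
proof -
  have "norm (f x) * 1 \<le> norm (f x) * (1 + x\<^sup>2) ^ 2"
    by (intro mult_left_mono one_le_power) auto
  also have "\<dots> \<le> C" using assms by (simp add: decays_def)
  finally show ?thesis by simp
qed

lemma has_sum_int_nat:
  fixes f :: "int \<Rightarrow> 'a :: {topological_comm_monoid_add, t2_space}"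
  assumes "((\<lambda>n. f (int n)) has_sum S) UNIV" "((\<lambda>n. f (- int n - 1)) has_sum T) UNIV"
  shows "(f has_sum (S + T)) UNIV"
proof -
  have i1: "inj int" and i2: "inj (\<lambda>n. - int n - 1)" by (auto simp: inj_def)
  have 1: "(f has_sum S) (range int)" "(f has_sum T) (range (\<lambda>n. - int n - 1))"
    using assms by (simp_all add: has_sum_reindex[OF i1] has_sum_reindex[OF i2] o_def)
  have "k \<in> range int \<union> range (\<lambda>n. - int n - 1)" for k
  proof (cases "k \<ge> 0")
    case True then show ?thesis by (intro UnI1 image_eqI[of _ _ "nat k"]) auto
  next
    case False then show ?thesis by (intro UnI2 image_eqI[of _ _ "nat (- k - 1)"]) auto
  qed
  then have "range int \<union> range (\<lambda>n. - int n - 1) = UNIV" by blast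
  with has_sum_Un_disjoint[OF 1] show ?thesis by (fastforce simp: disjoint_iff)
qed

lemma summable_inverse_square_int: "(\<lambda>k::int. 1 / (1 + (real_of_int k)\<^sup>2)) summable_on UNIV"
proof -
  have s: "summable (\<lambda>n. inverse (real n ^ 2))" by (rule inverse_power_summable) simp
  have "summable (\<lambda>n. 1 / (1 + (real n)\<^sup>2))"
    by (rule summable_comparison_test_ev[OF _ s])
       (auto simp: divide_simps eventually_sequentially intro!: exI[of _ 1])
  moreover have "(\<lambda>n. 1 / (1 + (real_of_int (- int n - 1))\<^sup>2)) = (\<lambda>n. 1 / (1 + (real (Suc n))\<^sup>2))"
    by (intro ext arg_cong[of _ _ "\<lambda>z. 1 / (1 + z)"]) (simp add: power2_eq_square algebra_simps)
  moreover have "summable (\<lambda>n. 1 / (1 + (real (Suc n))\<^sup>2))"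
    using calculation(1) by (subst summable_Suc_iff)
  ultimately have "(\<lambda>n. 1 / (1 + (real_of_int (int n))\<^sup>2)) summable_on UNIV"
     "(\<lambda>n. 1 / (1 + (real_of_int (- int n - 1))\<^sup>2)) summable_on UNIV"
    by (auto intro!: summable_nonneg_imp_summable_on)
  from this[THEN has_sum_infsum] show ?thesis by (rule has_sum_imp_summable[OF has_sum_int_nat])
qed

text \<open>Bounds on rapidly decaying functions at lattice points are expressed through this weight. The
  square in the denominator is what makes even its first moment summable.\<close>

definition weight :: "int \<Rightarrow> real" where
  "weight p = 1 / (1 + (of_int p)\<^sup>2) ^ 2"

lemma weight_nonneg: "weight p \<ge> 0" by (simp add: weight_def)

lemma weight_linear_summable: "(\<lambda>p. \<bar>real_of_int p\<bar> * weight p) summable_on UNIV"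
proof (rule summable_on_comparison_test[OF summable_inverse_square_int])
  fix k :: int
  have "\<bar>real_of_int k\<bar> \<le> 1 + (real_of_int k)\<^sup>2"
    using sum_power2_ge_zero[of "\<bar>real_of_int k\<bar> - 1/2" 0] by (simp add: power2_eq_square algebra_simps)
  then show "\<bar>real_of_int k\<bar> * weight k \<le> 1 / (1 + (real_of_int k)\<^sup>2)"
    unfolding weight_def power2_eq_square[of "1 + (real_of_int k)\<^sup>2"] by (simp add: pos_divide_le_eq)
qed (simp add: weight_nonneg)

lemma weight_summable: "weight summable_on UNIV"
proof (rule summable_on_comparison_test[OF summable_inverse_square_int])
  fix k :: int
  have "1 + (real_of_int k)\<^sup>2 \<le> (1 + (real_of_int k)\<^sup>2) ^ 2" by (intro self_le_power) auto
  then show "weight k \<le> 1 / (1 + (real_of_int k)\<^sup>2)"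
    unfolding weight_def by (intro divide_left_mono) (auto intro!: mult_pos_pos simp: add_pos_nonneg)
qed (rule weight_nonneg)

text \<open>Shifting and rescaling the argument changes \<open>1 + p\<^sup>2\<close> by at most the constant factor \<open>1 + 2 (1 + Y\<^sup>2) / a\<^sup>2\<close>. The bound is uniform in \<open>lam \<ge> a\<close> and \<open>\<bar>y\<bar> \<le> Y\<close>, as is necessary for continuity of lattice sums in \<open>lam\<close>.\<close>

lemma decays_affine:
  assumes f: "decays f C" and "a > 0" "lam \<ge> a" "\<bar>y\<bar> \<le> Y"
  shows "norm (f (y + lam * p)) \<le> C * (1 + 2 * (1 + Y\<^sup>2) / a\<^sup>2)\<^sup>2 / (1 + (p)\<^sup>2) ^ 2"
proof -
  define t where "t = y + lam * p"
  define K where "K = 1 + 2 * (1 + Y\<^sup>2) / a\<^sup>2"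
  have "(a * p)\<^sup>2 \<le> (lam * p)\<^sup>2"
    using assms by (auto simp: power_mult_distrib intro!: mult_right_mono power_mono)
  also have "(lam * p)\<^sup>2 = (t - y)\<^sup>2" by (simp add: t_def)
  also have "\<dots> \<le> 2 * t\<^sup>2 + 2 * y\<^sup>2"
    using sum_power2_ge_zero[of "t + y" 0] by (simp add: power2_eq_square algebra_simps)
  also have "y\<^sup>2 \<le> Y\<^sup>2" using assms(4) by (simp add: abs_le_square_iff[symmetric])
  finally have 1: "a\<^sup>2 * (p)\<^sup>2 \<le> 2 * t\<^sup>2 + 2 * Y\<^sup>2" by (simp add: power_mult_distrib)
  have "2 * t\<^sup>2 + 2 * Y\<^sup>2 \<le> 2 * (1 + Y\<^sup>2) * (1 + t\<^sup>2)"
    by (simp add: algebra_simps)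
  with 1 have "a\<^sup>2 * (p)\<^sup>2 \<le> 2 * (1 + Y\<^sup>2) * (1 + t\<^sup>2)" by linarith
  then have "(p)\<^sup>2 \<le> 2 * (1 + Y\<^sup>2) / a\<^sup>2 * (1 + t\<^sup>2)"
    using \<open>a > 0\<close> by (simp add: field_simps)
  then have 2: "1 + (p)\<^sup>2 \<le> K * (1 + t\<^sup>2)"
    unfolding K_def by (simp add: distrib_right add_mono)
  have K: "K > 0" unfolding K_def using \<open>a > 0\<close> by (intro add_pos_nonneg) auto
  have "norm (f t) * (1 + (p)\<^sup>2)\<^sup>2 \<le> norm (f t) * (K * (1 + t\<^sup>2))\<^sup>2"
    using 2 by (intro mult_left_mono power_mono) auto
  also have "\<dots> = (norm (f t) * (1 + t\<^sup>2)\<^sup>2) * K\<^sup>2" by (simp add: power_mult_distrib)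
  also have "\<dots> \<le> C * K\<^sup>2" using f by (intro mult_right_mono) (auto simp: decays_def)
  finally show ?thesis
    unfolding t_def[symmetric] K_def[symmetric]
    by (subst pos_le_divide_eq) (auto intro!: zero_less_power)
qed

lemma decays_lattice:
  assumes "decays f C" "a > 0" "lam \<ge> a" "\<bar>y\<bar> \<le> Y"
  shows "norm (f (y + lam * of_int p)) \<le> C * (1 + 2 * (1 + Y\<^sup>2) / a\<^sup>2)\<^sup>2 * weight p"
  using decays_affine[OF assms, of "of_int p"] by (simp add: weight_def)

lemma decays_summable:
  fixes f :: "real \<Rightarrow> 'a :: banach"
  assumes "decays f C" "lam > 0"
  shows "(\<lambda>k::int. norm (f (y + lam * of_int k))) summable_on UNIV"
proof (rule summable_on_comparison_test)
  show "(\<lambda>k. C * (1 + 2 * (1 + \<bar>y\<bar>\<^sup>2) / lam\<^sup>2)\<^sup>2 * weight k) summable_on UNIV"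
    by (intro summable_on_cmult_right weight_summable)
  show "norm (f (y + lam * of_int k)) \<le> C * (1 + 2 * (1 + \<bar>y\<bar>\<^sup>2) / lam\<^sup>2)\<^sup>2 * weight k" for k
    using decays_lattice[OF assms order.refl order.refl, of y k] by simp
qed auto

text \<open>Up to the factor \<open>\<surd>lam\<close> this is the Zak transform of \<open>u\<close> with parameter \<open>lam\<close> at \<open>(1/6, 0)\<close>.\<close>

definition lattice_sum :: "(real \<Rightarrow> real) \<Rightarrow> real \<Rightarrow> real" where
  "lattice_sum u lam = (\<Sum>\<^sub>\<infinity>k\<in>(UNIV::int set). u (lam * (1/6 + of_int k)))"

lemma continuous_on_lattice_sum:
  assumes "decays u C" "continuous_on UNIV u" "a > 0"
  shows "continuous_on {a..b} (lattice_sum u)"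
proof -
  have "uniform_limit {a..b} (\<lambda>X lam. \<Sum>k\<in>X. u (lam * (1/6 + of_int k)))
      (\<lambda>lam. \<Sum>\<^sub>\<infinity>k\<in>(UNIV::int set). u (lam * (1/6 + of_int k))) (finite_subsets_at_top UNIV)"
  proof (rule Weierstrass_m_test_general)
    fix k :: int and lam assume lam: "lam \<in> {a..b}"
    have "norm (u (lam / 6 + lam * of_int k)) \<le> C * (1 + 2 * (1 + b\<^sup>2) / a\<^sup>2)\<^sup>2 * weight k"
      using lam assms by (intro decays_lattice) auto
    then show "norm (u (lam * (1/6 + of_int k))) \<le> C * (1 + 2 * (1 + b\<^sup>2) / a\<^sup>2)\<^sup>2 * weight k"
      by (simp add: algebra_simps)
  qed (intro summable_on_cmult_right weight_summable)
  then show ?thesis unfolding lattice_sum_def [abs_def]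
  proof (rule uniform_limit_theorem[rotated])
    show "\<forall>\<^sub>F X in finite_subsets_at_top UNIV. continuous_on {a..b} (\<lambda>lam. \<Sum>k\<in>X. u (lam * (1/6 + of_int k)))"
      by (intro always_eventually allI continuous_intros continuous_on_compose2[OF assms(2)]) auto
  qed simp
qed

text \<open>The points \<open>1/6 + k\<close> with \<open>k < 0\<close> are the negatives of \<open>5/6 + n\<close>, \<open>n \<ge> 0\<close>.\<close>

lemma lattice_sum_odd:
  assumes u: "decays u C" and odd: "\<And>x. u (- x) = - u x" and lam: "lam > 0"
  shows "summable (\<lambda>n. u (lam * (1/6 + real n)))" "summable (\<lambda>n. u (lam * (5/6 + real n)))"
    "lattice_sum u lam = (\<Sum>n. u (lam * (1/6 + real n))) - (\<Sum>n. u (lam * (5/6 + real n)))"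
proof -
  have s: "(\<lambda>n. u (y + lam * real n)) summable_on UNIV" for y
  proof -
    have "(\<lambda>k::int. u (y + lam * of_int k)) summable_on range int"
      by (rule summable_on_subset_banach[OF abs_summable_summable[OF decays_summable[OF u lam]] subset_UNIV])
    then show ?thesis by (subst (asm) summable_on_reindex) (auto simp: o_def inj_def)
  qed
  have sums: "(\<lambda>n. u (y + lam * real n)) sums (\<Sum>\<^sub>\<infinity>n. u (y + lam * real n))" for y
    by (rule has_sum_imp_sums[OF has_sum_infsum[OF s]])
  have arr: "lam * (c + real n) = lam * c + lam * real n" for c n by (rule distrib_left)
  show s1: "summable (\<lambda>n. u (lam * (1/6 + real n)))" and s5: "summable (\<lambda>n. u (lam * (5/6 + real n)))"
    unfolding arr by (rule sums_summable[OF sums])+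
  have 1: "((\<lambda>n. u (lam * (1/6 + real n))) has_sum (\<Sum>n. u (lam * (1/6 + real n)))) UNIV"
    unfolding arr using has_sum_infsum[OF s] sums_unique[OF sums] by metis
  have 5: "((\<lambda>n. u (lam * (5/6 + real n))) has_sum (\<Sum>n. u (lam * (5/6 + real n)))) UNIV"
    unfolding arr using has_sum_infsum[OF s] sums_unique[OF sums] by metis
  have "u (lam * (1/6 + of_int (- int n - 1))) = - u (lam * (5/6 + real n))" for n
    unfolding odd[symmetric] by (rule arg_cong[of _ _ u]) (simp add: algebra_simps)
  then have neg: "((\<lambda>n. u (lam * (1/6 + of_int (- int n - 1)))) has_sum - (\<Sum>n. u (lam * (5/6 + real n)))) UNIV"
    using 5 by (simp only: has_sum_uminus minus_minus)
  have "((\<lambda>k. u (lam * (1/6 + of_int k))) has_sum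
       (\<Sum>n. u (lam * (1/6 + real n))) + - (\<Sum>n. u (lam * (5/6 + real n)))) UNIV"
    by (rule has_sum_int_nat[OF _ neg]) (use 1 in simp)
  then show "lattice_sum u lam = (\<Sum>n. u (lam * (1/6 + real n))) - (\<Sum>n. u (lam * (5/6 + real n)))"
    unfolding lattice_sum_def by (simp add: infsumI)
qed

text \<open>The sampling points interleave as \<open>1/6 < 5/6 < 7/6 < 11/6 < \<dots>\<close>. Pairing 1/6 with 5/6, 7/6 with 11/6 and so on gives the positive sign; leaving 1/6 alone and pairing 5/6 with 7/6, 11/6 with 13/6 and so on gives the negative one.\<close>

lemma lattice_sum_signs:
  assumes u: "decays u C" and odd: "\<And>x. u (- x) = - u x"
    and T: "T > 0" and dec: "\<And>x y. T \<le> x \<Longrightarrow> x < y \<Longrightarrow> u y < u x"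
  shows "lattice_sum u (6 * T) > 0"
    and "\<And>x. x > 0 \<Longrightarrow> T \<le> 5 * x \<Longrightarrow> u x \<le> 0 \<Longrightarrow> lattice_sum u (6 * x) < 0"
proof -
  have lam: "6 * T > 0" using T by simp
  note s = lattice_sum_odd[OF u odd lam]
  have "0 < (\<Sum>n. u (6 * T * (1/6 + real n)) - u (6 * T * (5/6 + real n)))"
  proof (rule suminf_pos)
    fix n
    have "T * 1 \<le> T * (1 + 6 * real n)" using T by (intro mult_left_mono) auto
    then have "T \<le> 6 * T * (1/6 + real n)" by (simp add: algebra_simps)
    moreover have "6 * T * (1/6 + real n) < 6 * T * (5/6 + real n)" using T by (intro mult_strict_left_mono) auto
    ultimately show "0 < u (6 * T * (1/6 + real n)) - u (6 * T * (5/6 + real n))" using dec by simp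
  qed (intro summable_diff s)
  then show "lattice_sum u (6 * T) > 0" by (simp add: s suminf_diff)
next
  fix x assume x: "x > 0" "T \<le> 5 * x" "u x \<le> 0"
  have lam: "6 * x > 0" using x by simp
  note s = lattice_sum_odd[OF u odd lam]
  have s': "summable (\<lambda>n. u (6 * x * (1/6 + real (Suc n))))" using s(1) by (subst summable_Suc_iff)
  have "0 < (\<Sum>n. u (6 * x * (5/6 + real n)) - u (6 * x * (1/6 + real (Suc n))))"
  proof (rule suminf_pos)
    fix n
    have "x * 5 \<le> x * (5 + 6 * real n)" using x by (intro mult_left_mono) auto
    then have "T \<le> 6 * x * (5/6 + real n)" using x(2) by (simp add: algebra_simps)
    moreover have "6 * x * (5/6 + real n) < 6 * x * (1/6 + real (Suc n))" using x by (intro mult_strict_left_mono) auto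
    ultimately show "0 < u (6 * x * (5/6 + real n)) - u (6 * x * (1/6 + real (Suc n)))" using dec by simp
  qed (intro summable_diff s s')
  also have "\<dots> = (\<Sum>n. u (6 * x * (5/6 + real n))) - ((\<Sum>n. u (6 * x * (1/6 + real n))) - u (6 * x * (1/6 + real 0)))"
    by (simp only: suminf_diff[OF s(2) s', symmetric] suminf_split_head[OF s(1)])
  finally show "lattice_sum u (6 * x) < 0" using x(3) by (simp add: s(3))
qed

lemma hermite_gauss_decays: "\<exists>C. decays (hermite_gauss n) C"
  using poly_gauss_decay[of "hermite_poly n"] by (auto simp: decays_def)

lemma hermite_lattice_sum_zero:
  assumes "n \<ge> 3" "odd n"
  shows "\<exists>lam > sqrt 3. lattice_sum (hermite_gauss n) lam = 0"
proof -
  obtain C where C: "decays (hermite_gauss n) C" using hermite_gauss_decays by blast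
  obtain x where x: "x > sqrt 3 / 6" "turning_point n \<le> 5 * x" "x < turning_point n" "hermite_gauss n x \<le> 0"
    using hermite_gauss_nonpos_point[OF assms] by blast
  have x0: "x > 0" using x(1) by (smt (verit) real_sqrt_gt_zero divide_pos_pos)
  have odd: "hermite_gauss n (- x) = - hermite_gauss n x" for x
    using hermite_gauss_uminus[of n x] assms by simp
  have pos: "lattice_sum (hermite_gauss n) (6 * turning_point n) > 0"
    by (rule lattice_sum_signs(1)[OF C odd turning_point_pos hermite_gauss_decreasing])
  have neg: "lattice_sum (hermite_gauss n) (6 * x) < 0"
    by (rule lattice_sum_signs(2)[OF C odd turning_point_pos hermite_gauss_decreasing x0 x(2,4)])
  have "\<exists>lam\<ge>6 * x. lam \<le> 6 * turning_point n \<and> lattice_sum (hermite_gauss n) lam = 0"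
  proof (rule IVT'[of "lattice_sum (hermite_gauss n)"])
    show "continuous_on {6 * x..6 * turning_point n} (lattice_sum (hermite_gauss n))"
      using x0 by (intro continuous_on_lattice_sum[OF C] continuous_on_poly_gauss continuous_on_id) simp
  qed (use pos neg x(3) in simp_all)
  then obtain lam where "lam \<ge> 6 * x" "lattice_sum (hermite_gauss n) lam = 0" by blast
  then show ?thesis using x(1) by (intro exI[of _ lam]) auto
qed

section \<open>Bessel's inequality for exponentials\<close>

lemma cis_has_vector_derivative:
  "((\<lambda>y. cis (c * y)) has_vector_derivative (\<i> * of_real c * cis (c * y))) (at y within S)"
proof -
  have "((\<lambda>z. exp (\<i> * (of_real c * z))) has_field_derivative \<i> * of_real c * exp (\<i> * (of_real c * of_real y))) (at (of_real y))"
    by (rule derivative_eq_intros refl | simp)+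
  from has_vector_derivative_real_field[OF this, of S] show ?thesis
    by (simp add: cis_conv_exp)
qed

lemma continuous_on_cis_mult [continuous_intros]:
  "continuous_on S f \<Longrightarrow> continuous_on S (\<lambda>x. cis (f x))"
  unfolding cis_conv_exp by (intro continuous_intros)

lemma borel_measurable_cis [measurable (raw)]:
  "f \<in> borel_measurable M \<Longrightarrow> (\<lambda>x. cis (f x)) \<in> borel_measurable M"
  by (rule measurable_compose[OF _ borel_measurable_continuous_onI])
     (auto intro!: continuous_intros)

lemma borel_measurable_cnj [measurable (raw)]:
  "f \<in> borel_measurable M \<Longrightarrow> (\<lambda>x. cnj (f x)) \<in> borel_measurable M"
  by (rule measurable_compose[OF _ borel_measurable_continuous_onI])
     (auto intro!: continuous_intros)

lemma integral_cis_period: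
  fixes lam :: real and k :: int
  assumes "lam > 0"
  shows "(LINT y|lborel. indicator {a..a + lam} y *\<^sub>R cis (2 * pi * of_int k / lam * y)) = (if k = 0 then of_real lam else 0)"
proof (cases "k = 0")
  case True
  then show ?thesis using assms by (simp add: scaleR_conv_of_real)
next
  case False
  define c where "c = 2 * pi * of_int k / lam"
  have c: "c \<noteq> 0" using False assms by (simp add: c_def)
  have "(LINT y|lborel. indicator {a..a + lam} y *\<^sub>R cis (c * y))
        = cis (c * (a + lam)) / (\<i> * of_real c) - cis (c * a) / (\<i> * of_real c)"
  proof (rule integral_FTC_atLeastAtMost)
    show "((\<lambda>y. cis (c * y) / (\<i> * of_real c)) has_vector_derivative cis (c * x)) (at x within {a..a + lam})" for x
      using has_vector_derivative_divide[OF cis_has_vector_derivative[of c x "{a..a + lam}"], of "\<i> * of_real c"] c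
      by simp
  qed (use assms in \<open>auto intro!: continuous_intros\<close>)
  also have "cis (c * (a + lam)) = cis (c * a)"
  proof -
    have "c * (a + lam) = c * a + 2 * pi * of_int k" using assms by (simp add: c_def distrib_left)
    then show ?thesis by (simp flip: cis_mult) 
  qed
  finally show ?thesis using False by (simp add: c_def)
qed

text \<open>With \<open>T\<close> the sum of the exponentials weighted by the coefficients, this is \<open>(\<integral>\<bar>G - T/lam\<bar>\<^sup>2) \<ge> 0\<close> expanded.\<close>

lemma bessel_inequality:
  fixes G :: "real \<Rightarrow> complex" and lam :: real and M :: "int set"
  assumes lam: "lam > 0" and M: "finite M" and G [measurable]: "G \<in> borel_measurable borel"
    and K: "\<And>y. norm (G y) \<le> K"
  shows "(\<Sum>m\<in>M. (cmod (LINT y|lborel. indicator {a..a + lam} y *\<^sub>R (cis (- (2 * pi * of_int m / lam * y)) * G y)))\<^sup>2)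
     \<le> lam * (LINT y|lborel. indicator {a..a + lam} y *\<^sub>R (cmod (G y))\<^sup>2)"
proof -
  define \<mu> where "\<mu> = restrict_space lborel {a..a + lam}"
  have I: "integral\<^sup>L \<mu> f = (LINT y|lborel. indicator {a..a + lam} y *\<^sub>R f y)" for f :: "real \<Rightarrow> 'b::{banach, second_countable_topology}"
    unfolding \<mu>_def by (rule integral_restrict_space) simp
  interpret finite_measure \<mu>
    unfolding \<mu>_def by (rule finite_measureI) (use lam in \<open>simp add: emeasure_restrict_space space_restrict_space\<close>)
  have meas: "f \<in> borel_measurable \<mu>" if "f \<in> borel_measurable borel" for f :: "real \<Rightarrow> complex"
    unfolding \<mu>_def by (rule measurable_restrict_space1) (subst measurable_lborel2, rule that)
  have intg: "integrable \<mu> f" if "f \<in> borel_measurable borel" "\<And>y. norm (f y) \<le> B" for f :: "real \<Rightarrow> complex" and B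
    by (rule integrable_const_bound[OF AE_I2[OF that(2)] meas[OF that(1)]])
  define e where "e m y = cis (2 * pi * of_int m / lam * y)" for m :: int and y :: real
  have e_cnj: "cnj (e m y) = cis (- (2 * pi * of_int m / lam * y))" for m y by (simp add: e_def cis_cnj)
  have e_meas [measurable]: "e m \<in> borel_measurable borel" for m unfolding e_def [abs_def] by measurable
  have e_norm [simp]: "norm (e m y) = 1" for m y by (simp add: e_def)
  have orth: "integral\<^sup>L \<mu> (\<lambda>y. e m y * cnj (e m' y)) = (if m = m' then of_real lam else 0)" for m m'
  proof -
    have "e m y * cnj (e m' y) = cis (2 * pi * of_int (m - m') / lam * y)" for y
      by (simp add: e_def cis_cnj cis_mult left_diff_distrib right_diff_distrib diff_divide_distrib)
    then show ?thesis using integral_cis_period[OF lam, of a "m - m'"] by (simp add: I)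
  qed
  define A where "A m = integral\<^sup>L \<mu> (\<lambda>y. G y * cnj (e m y))" for m
  define T where "T y = (\<Sum>m\<in>M. A m * e m y)" for y
  have T_meas [measurable]: "T \<in> borel_measurable borel" unfolding T_def [abs_def] by measurable
  have T_bd: "norm (T y) \<le> (\<Sum>m\<in>M. norm (A m))" for y
    unfolding T_def by (rule order.trans[OF norm_sum]) (simp add: norm_mult)
  define S where "S = (\<Sum>m\<in>M. (cmod (A m))\<^sup>2)"
  have Ge: "integrable \<mu> (\<lambda>y. G y * cnj (e m y))" for m
    by (rule intg[of _ K], measurable) (use K in \<open>auto simp: norm_mult\<close>)
  have GT: "integral\<^sup>L \<mu> (\<lambda>y. G y * cnj (T y)) = of_real S"
  proof -
    have "(\<lambda>y. G y * cnj (T y)) = (\<lambda>y. \<Sum>m\<in>M. cnj (A m) * (G y * cnj (e m y)))"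
      by (simp add: T_def sum_distrib_left mult_ac)
    then have "integral\<^sup>L \<mu> (\<lambda>y. G y * cnj (T y)) = (\<Sum>m\<in>M. cnj (A m) * A m)"
      using Ge by (simp add: A_def)
    then show ?thesis by (simp add: S_def complex_norm_square mult.commute flip: of_real_power)
  qed
  have GTi: "integrable \<mu> (\<lambda>y. G y * cnj (T y))"
    by (rule intg[of _ "K * (\<Sum>m\<in>M. norm (A m))"], measurable) (use K T_bd in \<open>auto simp: norm_mult intro!: mult_mono order.trans[OF norm_ge_zero K]\<close>)
  have TG: "integral\<^sup>L \<mu> (\<lambda>y. T y * cnj (G y)) = of_real S"
  proof -
    have "integral\<^sup>L \<mu> (\<lambda>y. cnj (G y * cnj (T y))) = cnj (of_real S)"
      using integral_bounded_linear[OF bounded_linear_cnj GTi] by (simp only: GT)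
    then show ?thesis by (simp add: mult.commute)
  qed
  have TT: "integral\<^sup>L \<mu> (\<lambda>y. T y * cnj (T y)) = of_real (lam * S)"
  proof -
    have *: "(\<lambda>y. T y * cnj (T y)) = (\<lambda>y. \<Sum>m\<in>M. \<Sum>m'\<in>M. A m * cnj (A m') * (e m y * cnj (e m' y)))"
      by (simp add: T_def sum_product mult_ac)
    have ee: "integrable \<mu> (\<lambda>y. e m y * cnj (e m' y))" for m m'
      by (rule intg[of _ 1], measurable) (auto simp: norm_mult)
    have "integral\<^sup>L \<mu> (\<lambda>y. T y * cnj (T y)) = (\<Sum>m\<in>M. \<Sum>m'\<in>M. A m * cnj (A m') * (if m = m' then of_real lam else 0))"
      unfolding * using ee by (simp add: orth)
    also have "\<dots> = (\<Sum>m\<in>M. A m * cnj (A m) * of_real lam)"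
      using M by (intro sum.cong refl) (simp add: if_distrib[of "\<lambda>z. _ * z"] cong: if_cong)
    finally show ?thesis by (simp add: S_def complex_norm_square sum_distrib_left mult.commute flip: of_real_power)
  qed
  have Gi: "integrable \<mu> (\<lambda>y. G y * cnj (G y))"
    by (rule intg[of _ "K * K"], measurable) (use K in \<open>auto simp: norm_mult intro!: mult_mono order.trans[OF norm_ge_zero K]\<close>)
  have TGi: "integrable \<mu> (\<lambda>y. T y * cnj (G y))"
    by (rule intg[of _ "(\<Sum>m\<in>M. norm (A m)) * K"], measurable) (use K T_bd in \<open>auto simp: norm_mult intro!: mult_mono sum_nonneg\<close>)
  have TTi: "integrable \<mu> (\<lambda>y. T y * cnj (T y))"
    by (rule intg[of _ "(\<Sum>m\<in>M. norm (A m)) * (\<Sum>m\<in>M. norm (A m))"], measurable) (use T_bd in \<open>auto simp: norm_mult intro!: mult_mono sum_nonneg\<close>)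
  define E where "E = integral\<^sup>L \<mu> (\<lambda>y. (cmod (G y))\<^sup>2)"
  have GG: "integral\<^sup>L \<mu> (\<lambda>y. G y * cnj (G y)) = of_real E"
    unfolding E_def integral_complex_of_real[symmetric] by (simp add: complex_norm_square flip: of_real_power)
  have "complex_of_real (integral\<^sup>L \<mu> (\<lambda>y. (cmod (G y - T y / of_real lam))\<^sup>2))
      = integral\<^sup>L \<mu> (\<lambda>y. (G y - T y / of_real lam) * cnj (G y - T y / of_real lam))"
    unfolding integral_complex_of_real[symmetric] by (simp add: complex_norm_square flip: of_real_power)
  also have "\<dots> = integral\<^sup>L \<mu> (\<lambda>y. G y * cnj (G y) - T y * cnj (G y) / of_real lam
        - G y * cnj (T y) / of_real lam + T y * cnj (T y) / (of_real lam * of_real lam))"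
    by (intro Bochner_Integration.integral_cong refl) (simp add: algebra_simps)
  also have "\<dots> = of_real E - of_real S / of_real lam - of_real S / of_real lam + of_real (lam * S) / (of_real lam * of_real lam)"
    using Gi GTi TGi TTi by (simp add: GG TG GT TT)
  also have "\<dots> = of_real (E - S / lam)" using lam by (simp add: field_simps)
  finally have "integral\<^sup>L \<mu> (\<lambda>y. (cmod (G y - T y / of_real lam))\<^sup>2) = E - S / lam"
    by (simp only: of_real_eq_iff)
  moreover have "integral\<^sup>L \<mu> (\<lambda>y. (cmod (G y - T y / of_real lam))\<^sup>2) \<ge> 0" by simp
  ultimately have "S / lam \<le> E" by linarith
  then have "S \<le> lam * E" using lam by (simp add: pos_divide_le_eq mult.commute)
  then show ?thesis unfolding S_def E_def A_def I e_cnj by (simp add: mult.commute)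
qed

section \<open>An obstruction to the frame property\<close>

text \<open>A shift by \<open>p\<close> moves at most \<open>\<bar>p\<bar>\<close> integers across each of the two ends of an interval, however long the interval is.\<close>

lemma card_boundary_crossings:
  fixes L :: int and p :: int
  assumes "finite Q"
  shows "card {q\<in>Q. (q + p \<in> {0..<L}) \<noteq> (q \<in> {0..<L})} \<le> 2 * nat \<bar>p\<bar>"
proof -
  have "{q\<in>Q. (q + p \<in> {0..<L}) \<noteq> (q \<in> {0..<L})}
      \<subseteq> {L - max p 0..<L - min p 0} \<union> {- max p 0..<- min p 0}"
    by auto
  then have "card {q\<in>Q. (q + p \<in> {0..<L}) \<noteq> (q \<in> {0..<L})}
      \<le> card ({L - max p 0..<L - min p 0} \<union> {- max p 0..<- min p 0})"
    by (intro card_mono) auto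
  also have "\<dots> \<le> card {L - max p 0..<L - min p 0} + card {- max p 0..<- min p 0}"
    by (rule card_Un_le)
  also have "\<dots> = 2 * nat \<bar>p\<bar>" by (cases "p \<ge> 0") (auto simp: max_def min_def)
  finally show ?thesis .
qed

lemma card_boundary_crossings_div:
  fixes L p :: int and N :: nat
  assumes "finite F" "N > 0"
  shows "card {k\<in>F. (k div int N + p \<in> {0..<L}) \<noteq> (k div int N \<in> {0..<L})} \<le> 2 * N * nat \<bar>p\<bar>"
proof -
  define Q where "Q = {q \<in> (\<lambda>k. k div int N) ` F. (q + p \<in> {0..<L}) \<noteq> (q \<in> {0..<L})}"
  have Q: "finite Q" "card Q \<le> 2 * nat \<bar>p\<bar>"
    unfolding Q_def using assms card_boundary_crossings by auto
  have "{k\<in>F. (k div int N + p \<in> {0..<L}) \<noteq> (k div int N \<in> {0..<L})}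
      \<subseteq> (\<lambda>(q, j). int N * q + j) ` (Q \<times> {0..<int N})"
  proof
    fix k assume k: "k \<in> {k\<in>F. (k div int N + p \<in> {0..<L}) \<noteq> (k div int N \<in> {0..<L})}"
    then have "k div int N \<in> Q" by (auto simp: Q_def)
    then show "k \<in> (\<lambda>(q, j). int N * q + j) ` (Q \<times> {0..<int N})"
      using assms by (intro image_eqI[of _ _ "(k div int N, k mod int N)"]) auto
  qed
  then have "card {k\<in>F. (k div int N + p \<in> {0..<L}) \<noteq> (k div int N \<in> {0..<L})}
      \<le> card ((\<lambda>(q, j). int N * q + j) ` (Q \<times> {0..<int N}))"
    using Q by (intro card_mono finite_imageI) auto
  also have "\<dots> \<le> card (Q \<times> {0..<int N})" using Q by (intro card_image_le) auto
  also have "\<dots> = card Q * N" by (simp add: card_cartesian_product)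
  also have "\<dots> \<le> 2 * nat \<bar>p\<bar> * N" using Q by (intro mult_right_mono) auto
  finally show ?thesis by (simp add: mult_ac)
qed

lemma has_sum_finite_sum:
  fixes f :: "'i \<Rightarrow> 'a \<Rightarrow> 'b :: topological_comm_monoid_add"
  assumes "finite F" "\<And>k. k \<in> F \<Longrightarrow> (f k has_sum s k) A"
  shows "((\<lambda>x. \<Sum>k\<in>F. f k x) has_sum (\<Sum>k\<in>F. s k)) A"
  using assms by (induction F rule: finite_induct) (auto intro: has_sum_add)

lemma integrable_indicator_Icc:
  fixes f :: "real \<Rightarrow> 'a :: euclidean_space"
  shows "continuous_on {a..b} f \<Longrightarrow> integrable lborel (\<lambda>x. indicator {a..b} x *\<^sub>R f x)"
  using borel_integrable_atLeastAtMost'[of a b f] by (simp only: set_integrable_def)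

text \<open>The window \<open>g\<close> has \<open>N\<close> Zak transform values that vanish simultaneously. The numbers \<open>x1\<close>, \<open>\<theta>\<close> describe the common zero, \<open>x1\<close> being rescaled by \<open>lam\<close> and \<open>\<theta> = - 2 \<pi> \<gamma>\<close>.\<close>

locale gabor_obstruction =
  fixes g :: "real \<Rightarrow> complex" and lam x1 \<theta> C :: real and N :: nat
  assumes lam: "lam > 0" and N: "N > 0"
    and cont: "continuous_on UNIV g" and decay: "decays g C"
    and zero: "\<And>j. j < N \<Longrightarrow>
      (\<Sum>\<^sub>\<infinity>l\<in>(UNIV::int set). cis (\<theta> * of_int l) * g (x1 + lam * of_int l - lam / N * real j)) = 0"
begin

definition step :: real where "step = lam / N"

text \<open>A Zak sum of the time shift of \<open>g\<close> by \<open>step * k\<close>, truncated to \<open>L\<close> terms. Up to conjugation this is what a comb of narrow spikes at the points \<open>y + lam l\<close>, \<open>0 \<le> l < L\<close>, measures.\<close>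

definition corr :: "nat \<Rightarrow> int \<Rightarrow> real \<Rightarrow> complex" where
  "corr L k y = (\<Sum>l\<in>{0..<int L}. cis (\<theta> * of_int l) * g (y + lam * of_int l - step * of_int k))"

lemma step_pos: "step > 0" using lam N by (simp add: step_def)

text \<open>Since \<open>N\<close> steps make up one period \<open>lam\<close>, the shifts by \<open>step * k\<close> fall into \<open>N\<close> classes; \<open>k div N\<close> counts the periods.\<close>

lemma step_decomp: "step * of_int k = lam * of_int (k div int N) + step * of_int (k mod int N)"
proof -
  have "of_int k = of_int (int N * (k div int N) + k mod int N)" by simp
  also have "\<dots> = real N * of_int (k div int N) + of_int (k mod int N)"
    by (simp only: of_int_add of_int_mult of_int_of_nat_eq)
  finally have "step * of_int k = (step * real N) * of_int (k div int N) + step * of_int (k mod int N)"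
    by (simp add: distrib_left)
  also have "step * real N = lam" using N by (simp add: step_def)
  finally show ?thesis .
qed

lemma step_mod: "\<bar>step * of_int (k mod int N)\<bar> \<le> lam"
proof -
  have "0 \<le> k mod int N" "k mod int N < int N" using N by auto
  then have "step * of_int (k mod int N) \<le> step * N" "0 \<le> step * of_int (k mod int N)"
    using step_pos by (auto intro!: mult_left_mono)
  then show ?thesis using N by (simp add: step_def)
qed

lemma zero_all: "((\<lambda>l. cis (\<theta> * of_int l) * g (x1 + lam * of_int l - step * of_int k)) has_sum 0) UNIV"
proof -
  define q where "q = k div int N"
  define j where "j = nat (k mod int N)"
  have j: "j < N" "real j = of_int (k mod int N)" using N by (auto simp: j_def nat_less_iff)
  have "(\<lambda>l::int. norm (cis (\<theta> * of_int l) * g (x1 - step * real j + lam * of_int l))) summable_on UNIV"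
    using decays_summable[OF decay lam, of "x1 - step * real j"] by (simp add: norm_mult)
  from has_sum_infsum[OF abs_summable_summable[OF this]]
  have "((\<lambda>l::int. cis (\<theta> * of_int l) * g (x1 + lam * of_int l - step * real j)) has_sum 0) UNIV"
    using zero[OF j(1)] by (simp add: step_def algebra_simps)
  then have "((\<lambda>l::int. cis (\<theta> * of_int q) * (cis (\<theta> * of_int l) * g (x1 + lam * of_int l - step * real j))) has_sum
       cis (\<theta> * of_int q) * 0) UNIV"
    by (rule has_sum_cmult_right)
  also have "(\<lambda>l::int. cis (\<theta> * of_int q) * (cis (\<theta> * of_int l) * g (x1 + lam * of_int l - step * real j)))
     = (\<lambda>l. cis (\<theta> * of_int (q + l)) * g (x1 + lam * of_int (q + l) - step * of_int k))"
    unfolding step_decomp[of k] j(2) q_def[symmetric]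
    by (rule ext) (simp add: cis_mult algebra_simps flip: mult.assoc)
  finally show ?thesis
    by (subst (asm) has_sum_reindex_bij_betw[where g = "\<lambda>l. q + l" and B = UNIV, OF bij_betwI[of _ _ _ "\<lambda>l. l - q"]]) simp_all
qed

text \<open>A bound for \<open>g\<close> on the lattice relative to the period \<open>k div N\<close>, uniform in \<open>k\<close>.\<close>

definition D where "D = C * (1 + 2 * (1 + (\<bar>x1\<bar> + lam)\<^sup>2) / lam\<^sup>2)\<^sup>2"

lemma D_nonneg: "D \<ge> 0" using decays_nonneg[OF decay] by (simp add: D_def)

lemma g_bound: "norm (g (x1 + lam * of_int (k div int N + p) - step * of_int k)) \<le> D * weight p"
proof -
  have "x1 + lam * of_int (k div int N + p) - step * of_int k = (x1 - step * of_int (k mod int N)) + lam * of_int p"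
    unfolding step_decomp[of k] by (simp add: algebra_simps)
  moreover have "\<bar>x1 - step * of_int (k mod int N)\<bar> \<le> \<bar>x1\<bar> + lam" using step_mod[of k] by linarith
  from decays_lattice[OF decay lam order.refl this, of p]
  have "norm (g ((x1 - step * of_int (k mod int N)) + lam * of_int p)) \<le> D * weight p"
    by (simp add: D_def weight_def)
  ultimately show ?thesis by (simp only:)
qed

definition W where "W = (\<Sum>\<^sub>\<infinity>p. weight p)"


text \<open>The full Zak sum is zero, so a constant multiple of it may be subtracted: with the constant chosen as the value of the truncation at the centre \<open>k div N\<close>, only those terms survive for which the truncation differs between the centre and the point at distance \<open>p\<close>.\<close>

lemma corr_bound:
  "norm (corr L k x1) \<le> (\<Sum>\<^sub>\<infinity>p. of_bool ((k div int N + p \<in> {0..<int L}) \<noteq> (k div int N \<in> {0..<int L})) * (D * weight p))"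
proof -
  define q where "q = k div int N"
  define t where "t l = cis (\<theta> * of_int l) * g (x1 + lam * of_int l - step * of_int k)" for l
  have "(t has_sum 0) UNIV" unfolding t_def [abs_def] by (rule zero_all)
  then have 1: "((\<lambda>l. - of_bool (q \<in> {0..<int L}) * t l) has_sum - of_bool (q \<in> {0..<int L}) * 0) UNIV"
    by (rule has_sum_cmult_right)
  have 2: "((\<lambda>l. of_bool (l \<in> {0..<int L}) * t l) has_sum corr L k x1) UNIV"
  proof -
    have "(t has_sum (sum t {0..<int L})) {0..<int L}" by (rule has_sum_finite) simp
    then show ?thesis
      by (subst (asm) has_sum_cong_neutral[where T = UNIV and g = "\<lambda>l. of_bool (l \<in> {0..<int L}) * t l"])
         (auto simp: corr_def t_def)
  qed
  have 3: "((\<lambda>l. (of_bool (l \<in> {0..<int L}) - of_bool (q \<in> {0..<int L})) * t l) has_sum corr L k x1) UNIV"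
    using has_sum_add[OF 2 1] by (simp add: left_diff_distrib)
  then have 4: "((\<lambda>p. (of_bool (q + p \<in> {0..<int L}) - of_bool (q \<in> {0..<int L})) * t (q + p)) has_sum corr L k x1) UNIV"
    by (subst has_sum_reindex_bij_betw[where g = "\<lambda>l. q + l" and B = UNIV and f = "\<lambda>l. (of_bool (l \<in> {0..<int L}) - of_bool (q \<in> {0..<int L})) * t l", OF bij_betwI[of _ _ _ "\<lambda>l. l - q"]]) simp_all
  have s: "(\<lambda>p. of_bool ((q + p \<in> {0..<int L}) \<noteq> (q \<in> {0..<int L})) * (D * weight p)) summable_on UNIV"
    by (rule summable_on_comparison_test[OF summable_on_cmult_right[OF weight_summable, of D]])
       (use D_nonneg weight_nonneg in auto)
  show ?thesis unfolding q_def[symmetric]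
  proof (rule norm_infsum_le[OF 4 has_sum_infsum[OF s]])
    fix p
    have "norm (t (q + p)) \<le> D * weight p"
      using g_bound[of k p] by (simp add: t_def q_def norm_mult)
    then show "norm ((of_bool (q + p \<in> {0..<int L}) - of_bool (q \<in> {0..<int L})) * t (q + p))
        \<le> of_bool ((q + p \<in> {0..<int L}) \<noteq> (q \<in> {0..<int L})) * (D * weight p)"
      by (auto simp: norm_mult)
  qed
qed

lemma corr_bound_uniform: "norm (corr L k x1) \<le> D * W"
proof (rule order.trans[OF corr_bound])
  have "(\<Sum>\<^sub>\<infinity>p. of_bool ((k div int N + p \<in> {0..<int L}) \<noteq> (k div int N \<in> {0..<int L})) * (D * weight p)) \<le> (\<Sum>\<^sub>\<infinity>p. D * weight p)"
    using D_nonneg weight_nonneg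
    by (intro infsum_mono summable_on_cmult_right weight_summable
         summable_on_comparison_test[OF summable_on_cmult_right[OF weight_summable, of D]]) auto
  then show "(\<Sum>\<^sub>\<infinity>p. of_bool ((k div int N + p \<in> {0..<int L}) \<noteq> (k div int N \<in> {0..<int L})) * (D * weight p)) \<le> D * W"
    by (simp add: W_def infsum_cmult_right')
qed

text \<open>A bound that is independent of the truncation length \<open>L\<close>, whereas the squared norm of the test function grows linearly in \<open>L\<close>.\<close>

definition B where "B = (D * W) * (D * (2 * N * (\<Sum>\<^sub>\<infinity>p. \<bar>real_of_int p\<bar> * weight p)))"

text \<open>Summing the bound of \<open>corr_bound\<close> over \<open>k\<close> first, each \<open>p\<close> contributes only for the at most \<open>2 N \<bar>p\<bar>\<close> values of \<open>k\<close> near the two ends of the truncation.\<close>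

lemma corr_square_sum:
  assumes F: "finite F"
  shows "(\<Sum>k\<in>F. (norm (corr L k x1))\<^sup>2) \<le> B"
proof -
  define d where "d k p = (of_bool ((k div int N + p \<in> {0..<int L}) \<noteq> (k div int N \<in> {0..<int L})) :: real)" for k p
  have s: "(\<lambda>p. d k p * (D * weight p)) summable_on UNIV" for k
    by (rule summable_on_comparison_test[OF summable_on_cmult_right[OF weight_summable, of D]])
       (use D_nonneg weight_nonneg in \<open>auto simp: d_def\<close>)
  have "(\<Sum>k\<in>F. norm (corr L k x1)) \<le> (\<Sum>k\<in>F. \<Sum>\<^sub>\<infinity>p. d k p * (D * weight p))"
    unfolding d_def by (intro sum_mono corr_bound)
  also have "\<dots> = (\<Sum>\<^sub>\<infinity>p. \<Sum>k\<in>F. d k p * (D * weight p))"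
    by (rule infsumI[symmetric], rule has_sum_finite_sum[OF F has_sum_infsum[OF s]])
  also have "\<dots> \<le> (\<Sum>\<^sub>\<infinity>p. D * (2 * N) * (\<bar>real_of_int p\<bar> * weight p))"
  proof (rule infsum_mono)
    show "(\<lambda>p. \<Sum>k\<in>F. d k p * (D * weight p)) summable_on UNIV"
      by (rule has_sum_imp_summable[OF has_sum_finite_sum[OF F has_sum_infsum[OF s]]])
    show "(\<lambda>p. D * (2 * N) * (\<bar>real_of_int p\<bar> * weight p)) summable_on UNIV"
      by (intro summable_on_cmult_right weight_linear_summable)
    fix p
    have "(\<Sum>k\<in>F. d k p) = real (card {k\<in>F. (k div int N + p \<in> {0..<int L}) \<noteq> (k div int N \<in> {0..<int L})})"
      using F by (simp add: d_def sum.If_cases of_bool_def Int_def del: atLeastLessThan_iff)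
    also have "\<dots> \<le> real (2 * N * nat \<bar>p\<bar>)"
      using card_boundary_crossings_div[OF F N] by (simp only: of_nat_le_iff)
    also have "\<dots> = 2 * N * \<bar>real_of_int p\<bar>" by simp
    finally have "(\<Sum>k\<in>F. d k p) * (D * weight p) \<le> 2 * N * \<bar>real_of_int p\<bar> * (D * weight p)"
      using D_nonneg weight_nonneg by (intro mult_right_mono) auto
    then show "(\<Sum>k\<in>F. d k p * (D * weight p)) \<le> D * (2 * N) * (\<bar>real_of_int p\<bar> * weight p)"
      unfolding sum_distrib_right[symmetric] by (simp add: mult_ac)
  qed
  also have "\<dots> = D * (2 * N * (\<Sum>\<^sub>\<infinity>p. \<bar>real_of_int p\<bar> * weight p))"
    by (simp add: infsum_cmult_right')
  finally have 1: "(\<Sum>k\<in>F. norm (corr L k x1)) \<le> D * (2 * N * (\<Sum>\<^sub>\<infinity>p. \<bar>real_of_int p\<bar> * weight p))" .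
  have W0: "D * W \<ge> 0" unfolding W_def using D_nonneg weight_nonneg by (intro mult_nonneg_nonneg infsum_nonneg) auto
  have "(\<Sum>k\<in>F. (norm (corr L k x1))\<^sup>2) \<le> (\<Sum>k\<in>F. (D * W) * norm (corr L k x1))"
    unfolding power2_eq_square by (intro sum_mono mult_right_mono corr_bound_uniform) auto
  also have "\<dots> \<le> B"
    unfolding B_def sum_distrib_left[symmetric] using 1 W0 by (intro mult_left_mono) auto
  finally show ?thesis .
qed

lemma corr_continuous: "continuous_on S (corr L k)"
  unfolding corr_def [abs_def]
  by (intro continuous_intros continuous_on_compose2[OF cont]) auto

text \<open>The bound at \<open>x1\<close> persists nearby because the sum over \<open>k\<close> is a continuous function, by uniform convergence.\<close>

lemma corr_square_bound_near:
  "\<exists>\<delta>>0. \<delta> < lam \<and> (\<forall>y\<in>{x1..x1 + \<delta>}. \<forall>F. finite F \<longrightarrow> (\<Sum>k\<in>F. (norm (corr L k y))\<^sup>2) \<le> B + 1)"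
proof -
  define Y where "Y = \<bar>x1\<bar> + 1 + lam * L"
  define K where "K = C * (1 + 2 * (1 + Y\<^sup>2) / step\<^sup>2)\<^sup>2"
  have bd: "(norm (corr L k y))\<^sup>2 \<le> (L * K)\<^sup>2 * weight k" if y: "y \<in> {x1..x1 + 1}" for k y
  proof -
    have "norm (cis (\<theta> * of_int l) * g (y + lam * of_int l - step * of_int k)) \<le> K * weight k"
      if l: "l \<in> {0..<int L}" for l
    proof -
      have "lam * of_int l \<le> lam * L" "0 \<le> lam * of_int l" using l lam by (auto intro!: mult_left_mono)
      then have "\<bar>y + lam * of_int l\<bar> \<le> Y" using y unfolding Y_def by auto
      from decays_lattice[OF decay step_pos order.refl this, of "- k"] show ?thesis
        by (simp add: norm_mult K_def weight_def)
    qed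
    then have "norm (corr L k y) \<le> (\<Sum>l\<in>{0..<int L}. K * weight k)"
      unfolding corr_def by (rule sum_norm_le)
    then have "norm (corr L k y) \<le> L * K * weight k" by simp
    then have "(norm (corr L k y))\<^sup>2 \<le> (L * K * weight k)\<^sup>2" by (rule power_mono) simp
    also have "\<dots> = (L * K)\<^sup>2 * (weight k * weight k)" by (simp add: power_mult_distrib power2_eq_square)
    also have "weight k * weight k \<le> 1 * weight k"
      by (rule mult_right_mono[OF _ weight_nonneg]) (simp add: weight_def)
    finally show ?thesis by (simp add: mult_left_mono)
  qed
  define \<Phi> where "\<Phi> y = (\<Sum>\<^sub>\<infinity>k. (norm (corr L k y))\<^sup>2)" for y
  have summ: "(\<lambda>k. (norm (corr L k y))\<^sup>2) summable_on UNIV" if "y \<in> {x1..x1 + 1}" for y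
    by (rule summable_on_comparison_test[OF summable_on_cmult_right[OF weight_summable, of "(L * K)\<^sup>2"]])
       (use bd[OF that] in auto)
  have "uniform_limit {x1..x1 + 1} (\<lambda>F y. \<Sum>k\<in>F. (norm (corr L k y))\<^sup>2) \<Phi> (finite_subsets_at_top UNIV)"
    unfolding \<Phi>_def
    by (rule Weierstrass_m_test_general[OF _ summable_on_cmult_right[OF weight_summable, of "(L * K)\<^sup>2"]])
       (use bd in auto)
  then have cont\<Phi>: "continuous_on {x1..x1 + 1} \<Phi>"
    by (rule uniform_limit_theorem[rotated])
       (auto intro!: always_eventually continuous_intros corr_continuous)
  have "\<Phi> x1 \<le> B"
    unfolding \<Phi>_def by (rule infsum_le_finite_sums[OF summ]) (auto intro: corr_square_sum)
  moreover obtain d where d: "d > 0" "\<And>y. y \<in> {x1..x1 + 1} \<Longrightarrow> dist y x1 < d \<Longrightarrow> dist (\<Phi> y) (\<Phi> x1) < 1"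
    using cont\<Phi> unfolding continuous_on_iff by (metis atLeastAtMost_iff less_add_one less_imp_le order.refl zero_less_one)
  ultimately have le: "\<Phi> y \<le> B + 1" if "y \<in> {x1..x1 + 1}" "dist y x1 < d" for y
    using that by (force simp: dist_real_def)
  define \<delta> where "\<delta> = min (min (d / 2) 1) (lam / 2)"
  have \<delta>: "\<delta> > 0" "\<delta> < lam" "\<delta> < d" "\<delta> \<le> 1" using d(1) lam by (auto simp: \<delta>_def)
  have "(\<Sum>k\<in>F. (norm (corr L k y))\<^sup>2) \<le> B + 1" if y: "y \<in> {x1..x1 + \<delta>}" and F: "finite F" for y F
  proof -
    have y': "y \<in> {x1..x1 + 1}" "dist y x1 < d" using y \<delta> by (auto simp: dist_real_def)
    have "(\<Sum>k\<in>F. (norm (corr L k y))\<^sup>2) \<le> \<Phi> y"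
      unfolding \<Phi>_def by (rule finite_sum_le_infsum[OF summ[OF y'(1)] F]) auto
    then show ?thesis using le[OF y'] by linarith
  qed
  then show ?thesis using \<delta> by blast
qed

text \<open>Spikes of width \<open>\<delta>\<close> at \<open>L\<close> consecutive points of \<open>x1 + lam \<int>\<close>, with the phases that align them with the vanishing Zak sums.\<close>

definition test_fun :: "nat \<Rightarrow> real \<Rightarrow> real \<Rightarrow> complex" where
  "test_fun L \<delta> x = (\<Sum>l\<in>{0..<int L}. indicator {x1 + lam * of_int l..x1 + lam * of_int l + \<delta>} x *\<^sub>R cnj (cis (\<theta> * of_int l)))"

lemma test_fun_norm_sq:
  assumes "0 < \<delta>" "\<delta> < lam"
  shows "(cmod (test_fun L \<delta> x))\<^sup>2 = (\<Sum>l\<in>{0..<int L}. indicator {x1 + lam * of_int l..x1 + lam * of_int l + \<delta>} x)"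
proof (cases "\<exists>l\<in>{0..<int L}. x \<in> {x1 + lam * of_int l..x1 + lam * of_int l + \<delta>}")
  case True
  then obtain l where l: "l \<in> {0..<int L}" "x \<in> {x1 + lam * of_int l..x1 + lam * of_int l + \<delta>}" by blast
  have other: "x \<notin> {x1 + lam * of_int l'..x1 + lam * of_int l' + \<delta>}" if "l' \<noteq> l" for l'
  proof
    assume x: "x \<in> {x1 + lam * of_int l'..x1 + lam * of_int l' + \<delta>}"
    have "lam * of_int l < lam * (of_int l' + 1)" "lam * of_int l' < lam * (of_int l + 1)"
      using x l(2) assms by (auto simp: distrib_left)
    then have "real_of_int l < of_int l' + 1" "real_of_int l' < of_int l + 1"
      using lam by (simp_all add: mult_less_cancel_left_pos)
    then show False using that by linarith
  qed
  have ind: "indicator {x1 + lam * of_int l'..x1 + lam * of_int l' + \<delta>} x = (if l' = l then 1 else 0 :: real)" for l'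
    using other[of l'] l(2) by (auto simp: indicator_def)
  show ?thesis unfolding test_fun_def ind
    using l(1) by (simp add: if_distrib[of "\<lambda>z. z *\<^sub>R _"] cong: if_cong)
next
  case False
  then have "indicator {x1 + lam * of_int l..x1 + lam * of_int l + \<delta>} x = (0::real)" if "l \<in> {0..<int L}" for l
    using that by (auto simp: indicator_def)
  then show ?thesis by (simp add: test_fun_def)
qed

lemma test_fun_L2:
  assumes "0 < \<delta>" "\<delta> < lam"
  shows "in_L2 (test_fun L \<delta>)" "(L2_norm (test_fun L \<delta>))\<^sup>2 = L * \<delta>"
proof -
  have meas: "test_fun L \<delta> \<in> borel_measurable lborel"
    unfolding test_fun_def [abs_def] by measurable
  have int: "integrable lborel (\<lambda>x. \<Sum>l\<in>{0..<int L}. indicator {x1 + lam * of_int l..x1 + lam * of_int l + \<delta>} x :: real)"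
    by (intro Bochner_Integration.integrable_sum integrable_real_indicator) (auto simp: emeasure_lborel_Icc_eq)
  show "in_L2 (test_fun L \<delta>)"
    unfolding in_L2_def test_fun_norm_sq[OF assms] using meas int by blast
  have "(\<integral>x. (cmod (test_fun L \<delta> x))\<^sup>2 \<partial>lborel) = (\<Sum>l\<in>{0..<int L}. \<delta>)"
    unfolding test_fun_norm_sq[OF assms] using assms
    by (subst Bochner_Integration.integral_sum) (auto intro!: integrable_real_indicator simp: emeasure_lborel_Icc_eq)
  then show "(L2_norm (test_fun L \<delta>))\<^sup>2 = L * \<delta>"
    unfolding L2_norm_def using assms by simp
qed

text \<open>All spikes are moved to the first one; the modulation by \<open>1 / lam\<close> is periodic with period \<open>lam\<close> and does not see the translations.\<close>

lemma test_fun_inner: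
  assumes "0 < \<delta>" "\<delta> < lam"
  shows "L2_inner (test_fun L \<delta>) (gabor_atom g step (1 / lam) (k, m))
     = (LINT y|lborel. indicator {x1..x1 + \<delta>} y *\<^sub>R (cis (- (2 * pi * of_int m / lam * y)) * cnj (corr L k y)))"
proof -
  define a where "a x = cis (- (2 * pi * of_int m / lam * x)) * cnj (g (x - step * of_int k))" for x
  have a: "a x = cnj (gabor_atom g step (1 / lam) (k, m) x)" for x
    by (simp add: a_def gabor_atom_def cis_cnj)
  have conta: "continuous_on S a" for S
    unfolding a_def [abs_def] by (intro continuous_intros continuous_on_compose2[OF cont]) auto
  define J where "J l = {x1 + lam * of_int l..x1 + lam * of_int l + \<delta>}" for l :: int
  have int: "integrable lborel (\<lambda>x. indicator (J l) x *\<^sub>R (cnj (cis (\<theta> * of_int l)) * a x))" for l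
    unfolding J_def by (intro integrable_indicator_Icc continuous_intros conta)
  have shift: "(LINT x|lborel. indicator (J l) x *\<^sub>R (cnj (cis (\<theta> * of_int l)) * a x))
      = (LINT y|lborel. indicator {x1..x1 + \<delta>} y *\<^sub>R (cnj (cis (\<theta> * of_int l)) * a (y + lam * of_int l)))" for l
  proof -
    have "indicator (J l) (lam * of_int l + 1 * y) = (indicator {x1..x1 + \<delta>} y :: real)" for y
      by (auto simp: J_def indicator_def)
    then show ?thesis
      by (subst lborel_integral_real_affine[where c = 1 and t = "lam * of_int l"]) (simp_all add: add.commute)
  qed
  have per: "a (y + lam * of_int l) = cis (- (2 * pi * of_int m / lam * y)) * cnj (g (y + lam * of_int l - step * of_int k))" for y l
  proof -
    have "- (2 * pi * of_int m / lam * (y + lam * of_int l)) = - (2 * pi * of_int m / lam * y) + 2 * pi * of_int (- m * l)"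
      using lam by (simp add: field_simps)
    then have "cis (- (2 * pi * of_int m / lam * (y + lam * of_int l))) = cis (- (2 * pi * of_int m / lam * y)) * cis (2 * pi * of_int (- m * l))"
      by (simp only: cis_mult)
    also have "cis (2 * pi * of_int (- m * l)) = 1" by (rule cis_multiple_2pi) simp
    finally show ?thesis by (simp add: a_def)
  qed
  have "L2_inner (test_fun L \<delta>) (gabor_atom g step (1 / lam) (k, m))
      = (LINT x|lborel. (\<Sum>l\<in>{0..<int L}. indicator (J l) x *\<^sub>R (cnj (cis (\<theta> * of_int l)) * a x)))"
    unfolding L2_inner_def a[symmetric] test_fun_def J_def
    by (simp add: sum_distrib_right)
  also have "\<dots> = (\<Sum>l\<in>{0..<int L}. LINT x|lborel. indicator (J l) x *\<^sub>R (cnj (cis (\<theta> * of_int l)) * a x))"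
    by (rule Bochner_Integration.integral_sum) (rule int)
  also have "\<dots> = (\<Sum>l\<in>{0..<int L}. LINT y|lborel. indicator {x1..x1 + \<delta>} y *\<^sub>R (cnj (cis (\<theta> * of_int l)) * a (y + lam * of_int l)))"
    by (simp only: shift)
  also have "\<dots> = (LINT y|lborel. (\<Sum>l\<in>{0..<int L}. indicator {x1..x1 + \<delta>} y *\<^sub>R (cnj (cis (\<theta> * of_int l)) * a (y + lam * of_int l))))"
  proof (rule Bochner_Integration.integral_sum[symmetric])
    fix l
    show "integrable lborel (\<lambda>y. indicator {x1..x1 + \<delta>} y *\<^sub>R (cnj (cis (\<theta> * of_int l)) * a (y + lam * of_int l)))"
      by (intro integrable_indicator_Icc continuous_intros continuous_on_compose2[OF conta[of UNIV]]) auto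
  qed
  also have "\<dots> = (LINT y|lborel. indicator {x1..x1 + \<delta>} y *\<^sub>R (cis (- (2 * pi * of_int m / lam * y)) * cnj (corr L k y)))"
    by (intro Bochner_Integration.integral_cong refl)
       (simp add: per corr_def sum_distrib_left scaleR_sum_right mult_ac)
  finally show ?thesis .
qed

lemma test_fun_row_sum:
  assumes \<delta>: "0 < \<delta>" "\<delta> < lam" and M: "finite M"
  shows "(\<Sum>m\<in>M. (cmod (L2_inner (test_fun L \<delta>) (gabor_atom g step (1 / lam) (k, m))))\<^sup>2)
     \<le> lam * (LINT y|lborel. indicator {x1..x1 + \<delta>} y *\<^sub>R (cmod (corr L k y))\<^sup>2)"
proof -
  define G where "G y = indicator {x1..x1 + \<delta>} y *\<^sub>R cnj (corr L k y)" for y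
  have [measurable]: "corr L k \<in> borel_measurable borel"
    by (rule borel_measurable_continuous_onI) (rule corr_continuous)
  have G [measurable]: "G \<in> borel_measurable borel" unfolding G_def [abs_def] by measurable
  have "norm (corr L k y) \<le> (\<Sum>l\<in>{0..<int L}. C)" for y
    unfolding corr_def using decays_le[OF decay] by (intro sum_norm_le) (simp add: norm_mult)
  then have bd: "norm (G y) \<le> (\<Sum>l\<in>{0..<int L}. C)" for y
    using decays_nonneg[OF decay] by (auto simp: G_def indicator_def)
  have sub: "indicator {x1..x1 + lam} y * (indicator {x1..x1 + \<delta>} y :: real) = indicator {x1..x1 + \<delta>} y" for y
    using \<delta> by (auto simp: indicator_def)
  have "(\<Sum>m\<in>M. (cmod (LINT y|lborel. indicator {x1..x1 + lam} y *\<^sub>R (cis (- (2 * pi * of_int m / lam * y)) * G y)))\<^sup>2)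
     \<le> lam * (LINT y|lborel. indicator {x1..x1 + lam} y *\<^sub>R (cmod (G y))\<^sup>2)"
    by (rule bessel_inequality[OF lam M G bd])
  also have "(\<lambda>y. indicator {x1..x1 + lam} y *\<^sub>R (cmod (G y))\<^sup>2) = (\<lambda>y. indicator {x1..x1 + \<delta>} y *\<^sub>R (cmod (corr L k y))\<^sup>2)"
    using \<delta> by (auto simp: G_def fun_eq_iff indicator_def)
  also have "(\<lambda>m y. indicator {x1..x1 + lam} y *\<^sub>R (cis (- (2 * pi * of_int m / lam * y)) * G y))
     = (\<lambda>m y. indicator {x1..x1 + \<delta>} y *\<^sub>R (cis (- (2 * pi * of_int m / lam * y)) * cnj (corr L k y)))"
    using \<delta> by (auto simp: G_def fun_eq_iff indicator_def)
  finally show ?thesis by (simp only: test_fun_inner[OF \<delta>])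
qed

text \<open>Testing the lower frame bound \<open>A\<close> with \<open>test_fun\<close> gives \<open>A L \<le> lam (B + 1)\<close> for every \<open>L\<close>.\<close>

theorem not_frame: "\<not> is_L2_frame (gabor_atom g (lam / N) (1 / lam))"
proof
  assume "is_L2_frame (gabor_atom g (lam / N) (1 / lam))"
  then obtain A where A: "A > 0" and frame: "\<And>f. in_L2 f \<Longrightarrow>
      (\<lambda>i. (cmod (L2_inner f (gabor_atom g step (1 / lam) i)))\<^sup>2) summable_on UNIV \<and>
      A * (L2_norm f)\<^sup>2 \<le> (\<Sum>\<^sub>\<infinity>i. (cmod (L2_inner f (gabor_atom g step (1 / lam) i)))\<^sup>2)"
    unfolding is_L2_frame_def step_def by blast
  have key: "A * L \<le> lam * (B + 1)" for L :: nat
  proof -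
    obtain \<delta> where \<delta>: "\<delta> > 0" "\<delta> < lam"
      and near: "\<And>y F. y \<in> {x1..x1 + \<delta>} \<Longrightarrow> finite F \<Longrightarrow> (\<Sum>k\<in>F. (norm (corr L k y))\<^sup>2) \<le> B + 1"
      using corr_square_bound_near[of L] by blast
    define c where "c i = (cmod (L2_inner (test_fun L \<delta>) (gabor_atom g step (1 / lam) i)))\<^sup>2" for i
    have "(\<Sum>\<^sub>\<infinity>i. c i) \<le> lam * (\<delta> * (B + 1))"
    proof (rule infsum_le_finite_sums)
      show "c summable_on UNIV"
        unfolding c_def [abs_def] using frame test_fun_L2(1)[OF \<delta>] by blast
      fix X :: "(int \<times> int) set" assume X: "finite X"
      have "sum c X \<le> sum c (fst ` X \<times> snd ` X)"
        using X by (intro sum_mono2) (auto simp: c_def intro: rev_image_eqI)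
      also have "\<dots> = (\<Sum>k\<in>fst ` X. \<Sum>m\<in>snd ` X. c (k, m))"
        by (simp add: sum.cartesian_product)
      also have "\<dots> \<le> (\<Sum>k\<in>fst ` X. lam * (LINT y|lborel. indicator {x1..x1 + \<delta>} y *\<^sub>R (cmod (corr L k y))\<^sup>2))"
        unfolding c_def using X by (intro sum_mono test_fun_row_sum \<delta>) auto
      also have "\<dots> = lam * (LINT y|lborel. (\<Sum>k\<in>fst ` X. indicator {x1..x1 + \<delta>} y *\<^sub>R (cmod (corr L k y))\<^sup>2))"
        unfolding sum_distrib_left[symmetric]
      proof (subst Bochner_Integration.integral_sum)
        show "integrable lborel (\<lambda>y. indicator {x1..x1 + \<delta>} y *\<^sub>R (cmod (corr L k y))\<^sup>2)" for k
          by (intro integrable_indicator_Icc continuous_intros corr_continuous)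
      qed simp
      also have "(LINT y|lborel. (\<Sum>k\<in>fst ` X. indicator {x1..x1 + \<delta>} y *\<^sub>R (cmod (corr L k y))\<^sup>2))
          \<le> (LINT y|lborel. indicator {x1..x1 + \<delta>} y *\<^sub>R (B + 1))"
      proof (rule integral_mono)
        show "integrable lborel (\<lambda>y. \<Sum>k\<in>fst ` X. indicator {x1..x1 + \<delta>} y *\<^sub>R (cmod (corr L k y))\<^sup>2)"
          unfolding scaleR_sum_right[symmetric] by (intro integrable_indicator_Icc continuous_intros corr_continuous)
        show "integrable lborel (\<lambda>y. indicator {x1..x1 + \<delta>} y *\<^sub>R (B + 1))"
          by (intro integrable_indicator_Icc continuous_intros)
        show "(\<Sum>k\<in>fst ` X. indicator {x1..x1 + \<delta>} y *\<^sub>R (cmod (corr L k y))\<^sup>2) \<le> indicator {x1..x1 + \<delta>} y *\<^sub>R (B + 1)" for y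
          using near[of y "fst ` X"] X by (cases "y \<in> {x1..x1 + \<delta>}") auto
      qed
      also have "(LINT y|lborel. indicator {x1..x1 + \<delta>} y *\<^sub>R (B + 1)) = \<delta> * (B + 1)"
        using \<delta> by simp
      finally show "sum c X \<le> lam * (\<delta> * (B + 1))" using lam by simp
    qed
    moreover have "A * (L * \<delta>) \<le> (\<Sum>\<^sub>\<infinity>i. c i)"
      using frame[OF test_fun_L2(1)[OF \<delta>, of L]] unfolding c_def test_fun_L2(2)[OF \<delta>] by blast
    ultimately have "\<delta> * (A * L) \<le> \<delta> * (lam * (B + 1))" by (simp add: mult_ac)
    then show ?thesis using \<delta> by (simp add: mult_le_cancel_left_pos)
  qed
  obtain L :: nat where "lam * (B + 1) / A < L" using reals_Archimedean2 by blast
  then show False using key[of L] A by (simp add: pos_divide_less_eq mult.commute)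
qed

end

section \<open>The Fourier transform of Hermite functions\<close>

lemma integrable_inverse_square: "integrable lborel (\<lambda>x::real. inverse (1 + x\<^sup>2))"
  using integrable_inverse_1_plus_square by (simp add: set_integrable_def einterval_def)

lemma decays_integrable:
  fixes f :: "real \<Rightarrow> 'a :: euclidean_space"
  assumes f: "decays f C" and [measurable]: "f \<in> borel_measurable borel"
  shows "integrable lborel f"
proof (rule Bochner_Integration.integrable_bound[of _ "\<lambda>x. C * inverse (1 + x\<^sup>2)"])
  show "integrable lborel (\<lambda>x. C * inverse (1 + x\<^sup>2))"
    using integrable_inverse_square by (rule integrable_mult_right)
  have "norm (f x) \<le> norm (C * inverse (1 + x\<^sup>2))" for x
  proof -
    have "norm (f x) * (1 + x\<^sup>2) \<le> norm (f x) * (1 + x\<^sup>2) ^ 2"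
      by (intro mult_left_mono self_le_power) auto
    also have "\<dots> \<le> C" using f by (simp add: decays_def)
    finally have "norm (f x) \<le> C / (1 + x\<^sup>2)" by (simp add: pos_le_divide_eq)
    also have "\<dots> \<le> norm (C * inverse (1 + x\<^sup>2))" by (simp add: divide_inverse)
    finally show ?thesis .
  qed
  then show "AE x in lborel. norm (f x) \<le> norm (C * inverse (1 + x\<^sup>2))" by simp
qed simp

definition fourier :: "(real \<Rightarrow> complex) \<Rightarrow> real \<Rightarrow> complex" where
  "fourier f \<xi> = (LINT x|lborel. cis (- (2 * pi * \<xi> * x)) * f x)"

lemma poly_gauss_decays: "\<exists>C. decays (\<lambda>x. complex_of_real (poly_gauss p x)) C"
  using poly_gauss_decay[of p] by (auto simp: decays_def)

lemma poly_gauss_measurable [measurable]: "poly_gauss p \<in> borel_measurable borel"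
  by (intro borel_measurable_continuous_onI continuous_on_poly_gauss continuous_on_id)

lemma decays_cis: "decays f C \<Longrightarrow> decays (\<lambda>x. cis (h x) * f x) C"
  by (simp add: decays_def norm_mult)

lemma poly_gauss_fourier_integrable:
  "integrable lborel (\<lambda>x. cis (- (2 * pi * \<xi> * x)) * complex_of_real (poly_gauss p x))"
proof -
  obtain C where C: "decays (\<lambda>x. complex_of_real (poly_gauss p x)) C" using poly_gauss_decays by blast
  show ?thesis
    by (rule decays_integrable[OF decays_cis[OF C, of "\<lambda>x. - (2 * pi * \<xi> * x)"]]) measurable
qed

lemma fourier_poly_gauss_diff:
  "fourier (\<lambda>x. of_real (poly_gauss (p - q) x)) \<xi> = fourier (\<lambda>x. of_real (poly_gauss p x)) \<xi> - fourier (\<lambda>x. of_real (poly_gauss q x)) \<xi>"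
  unfolding fourier_def poly_gauss_diff of_real_diff right_diff_distrib
  by (rule Bochner_Integration.integral_diff; rule poly_gauss_fourier_integrable)

lemma fourier_poly_gauss_smult:
  "fourier (\<lambda>x. of_real (poly_gauss (smult c p) x)) \<xi> = of_real c * fourier (\<lambda>x. of_real (poly_gauss p x)) \<xi>"
proof -
  have "cis (- (2 * pi * \<xi> * x)) * complex_of_real (poly_gauss (smult c p) x)
     = of_real c * (cis (- (2 * pi * \<xi> * x)) * complex_of_real (poly_gauss p x))" for x
    by (simp add: poly_gauss_smult)
  then show ?thesis unfolding fourier_def by (simp only: integral_mult_right_zero)
qed

text \<open>Integration by parts: the derivative of \<open>poly_gauss p\<close> times the exponential has integral 0 over the line.\<close>

lemma fourier_deriv_poly_gauss:
  "fourier (\<lambda>x. of_real (poly_gauss (pderiv p - [:0, 2 * pi:] * p) x)) \<xi>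
     = 2 * pi * \<i> * \<xi> * fourier (\<lambda>x. of_real (poly_gauss p x)) \<xi>"
proof -
  define q where "q = pderiv p - [:0, 2 * pi:] * p"
  define F where "F x = cis (- (2 * pi * \<xi>) * x) * complex_of_real (poly_gauss p x)" for x
  define F' where "F' x = cis (- (2 * pi * \<xi> * x)) * complex_of_real (poly_gauss q x)
      - 2 * pi * \<i> * \<xi> * (cis (- (2 * pi * \<xi> * x)) * complex_of_real (poly_gauss p x))" for x
  have int: "integrable lborel F'"
    unfolding F'_def
    by (intro Bochner_Integration.integrable_diff integrable_mult_right poly_gauss_fourier_integrable)
  have deriv: "(F has_vector_derivative F' x) (at x)" for x
  proof -
    have "((\<lambda>x. complex_of_real (poly_gauss p x)) has_vector_derivative of_real (poly_gauss q x)) (at x)"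
      using has_vector_derivative_of_real[OF poly_gauss_has_deriv[of p x]]
      by (simp add: q_def)
    from has_vector_derivative_mult[OF cis_has_vector_derivative[of "- (2 * pi * \<xi>)" x] this]
    show ?thesis unfolding F_def F'_def by (simp add: algebra_simps)
  qed
  have nF: "norm (F x) = norm (poly_gauss p x)" for x by (simp add: F_def norm_mult)
  have lim: "(F \<longlongrightarrow> 0) at_top" "(F \<longlongrightarrow> 0) at_bot"
    using poly_gauss_at_top[of p] poly_gauss_at_bot[of p]
    unfolding tendsto_norm_zero_iff[of F, symmetric] nF tendsto_norm_zero_iff by blast+
  have cF': "isCont F' x" for x
    unfolding F'_def
    by (intro continuous_on_interior[of UNIV] continuous_intros) auto
  have "(LBINT x=-\<infinity>..\<infinity>. F' x) = 0 - 0"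
    by (rule interval_integral_FTC_integrable[where F = F])
       (use int deriv lim cF' in \<open>simp_all add: ereal_tendsto_simps set_integrable_def einterval_def\<close>)
  then have "(LINT x|lborel. F' x) = 0"
    by (simp add: interval_lebesgue_integral_def set_lebesgue_integral_def einterval_def)
  moreover have "(LINT x|lborel. F' x) = fourier (\<lambda>x. of_real (poly_gauss q x)) \<xi>
       - 2 * pi * \<i> * \<xi> * fourier (\<lambda>x. of_real (poly_gauss p x)) \<xi>"
    unfolding F'_def fourier_def
    by (subst Bochner_Integration.integral_diff)
       (intro integrable_mult_right poly_gauss_fourier_integrable integral_mult_right_zero | simp)+
  ultimately show ?thesis by (simp add: q_def)
qed

lemma fourier_gauss: "fourier (\<lambda>x. of_real (exp (- pi * x\<^sup>2))) \<xi> = of_real (exp (- pi * \<xi>\<^sup>2))"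
proof -
  define s where "s = sqrt (2 * pi)"
  have s: "s > 0" "s * s = 2 * pi" "s\<^sup>2 = 2 * pi" by (simp_all add: s_def)
  have "complex_of_real (exp (- ((- (s * \<xi>))\<^sup>2) / 2)) = char std_normal_distribution (- (s * \<xi>))"
    by (simp add: char_std_normal_distribution)
  also have "\<dots> = (LINT x|lborel. std_normal_density x *\<^sub>R iexp (- (s * \<xi>) * x))"
    unfolding char_def by (subst integral_density) (auto simp: normal_density_nonneg)
  also have "\<dots> = s *\<^sub>R (LINT x|lborel. std_normal_density (0 + s * x) *\<^sub>R iexp (- (s * \<xi>) * (0 + s * x)))"
    using s by (subst lborel_integral_real_affine[where c = s and t = 0]) auto
  also have "\<dots> = (LINT x|lborel. s *\<^sub>R (std_normal_density (0 + s * x) *\<^sub>R iexp (- (s * \<xi>) * (0 + s * x))))"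
    by (rule integral_scaleR_right[symmetric])
  also have "\<dots> = (LINT x|lborel. cis (- (2 * pi * \<xi> * x)) * of_real (exp (- pi * x\<^sup>2)))"
  proof (intro Bochner_Integration.integral_cong refl)
    fix x
    have "s * std_normal_density (s * x) = exp (- pi * x\<^sup>2)"
      using s by (simp add: std_normal_density_def s_def[symmetric] power_mult_distrib)
    moreover have "- (s * \<xi>) * (s * x) = - (s * s * \<xi> * x)" by simp
    then have "iexp (- (s * \<xi>) * (s * x)) = cis (- (2 * pi * \<xi> * x))"
      by (simp only: s(2) cis_conv_exp)
    ultimately show "s *\<^sub>R (std_normal_density (0 + s * x) *\<^sub>R iexp (- (s * \<xi>) * (0 + s * x)))
        = cis (- (2 * pi * \<xi> * x)) * of_real (exp (- pi * x\<^sup>2))"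
      by (simp only: add_0_left scaleR_scaleR) (simp add: scaleR_conv_of_real)
  qed
  finally show ?thesis
    using s by (simp add: fourier_def power_mult_distrib)
qed

lemma hermite_gauss_0: "hermite_gauss 0 x = exp (- pi * x\<^sup>2)"
  by (simp add: poly_gauss_def)

text \<open>From the raising and lowering relations \<open>h\<^sub>n\<^sub>+\<^sub>1 = - 2 h\<^sub>n' + 4 \<pi> n h\<^sub>n\<^sub>-\<^sub>1\<close>, which involves no multiplication by \<open>x\<close>. Its Fourier transform is therefore computed by integration by parts alone, without differentiating under the integral sign, and reproduces the three-term recursion of the Hermite polynomials.\<close>

lemma fourier_hermite_gauss:
  "fourier (\<lambda>x. of_real (hermite_gauss n x)) \<xi> = (- \<i>) ^ n * of_real (hermite_gauss n \<xi>)"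
proof (induction n rule: induct_nat_012)
  case 0
  show ?case by (simp only: hermite_gauss_0 fourier_gauss) simp
next
  case 1
  have "hermite_poly 1 = smult (-2) (pderiv (hermite_poly 0) - [:0, 2 * pi:] * hermite_poly 0)"
    by simp
  then have "fourier (\<lambda>x. of_real (hermite_gauss 1 x)) \<xi> = of_real (-2) * (2 * pi * \<i> * \<xi> * fourier (\<lambda>x. of_real (hermite_gauss 0 x)) \<xi>)"
    by (simp only: fourier_poly_gauss_smult fourier_deriv_poly_gauss)
  then show ?case
    by (simp only: hermite_gauss_0 fourier_gauss) (simp add: poly_gauss_def)
next
  case (ge2 n)
  define c where "c = 4 * pi * (real n + 1)"
  define P where "P = hermite_poly (Suc n)"
  have pd: "pderiv P = smult c (hermite_poly n)"
    unfolding P_def c_def by (rule pderiv_hermite_poly)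
  define E where "E = pderiv P - [:0, 2 * pi:] * P"
  have fE: "fourier (\<lambda>x. of_real (poly_gauss E x)) \<xi> = 2 * pi * \<i> * \<xi> * fourier (\<lambda>x. of_real (hermite_gauss (Suc n) x)) \<xi>"
    unfolding E_def P_def by (rule fourier_deriv_poly_gauss)
  have S: "hermite_poly (Suc (Suc n)) = [:0, 4 * pi:] * P - pderiv P" by (simp add: P_def)
  have "hermite_poly (Suc (Suc n)) = smult c (hermite_poly n) - smult 2 E"
    unfolding S pd E_def by (rule poly_ext) (simp add: algebra_simps)
  then have "fourier (\<lambda>x. of_real (hermite_gauss (Suc (Suc n)) x)) \<xi>
      = of_real c * fourier (\<lambda>x. of_real (hermite_gauss n x)) \<xi>
        - of_real 2 * (2 * pi * \<i> * \<xi> * fourier (\<lambda>x. of_real (hermite_gauss (Suc n) x)) \<xi>)"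
    by (simp only: fourier_poly_gauss_diff fourier_poly_gauss_smult fE)
  also have "\<dots> = (- \<i>) ^ Suc (Suc n) * of_real (4 * pi * \<xi> * hermite_gauss (Suc n) \<xi> - c * hermite_gauss n \<xi>)"
    unfolding ge2.IH by (simp add: algebra_simps)
  also have "4 * pi * \<xi> * hermite_gauss (Suc n) \<xi> - c * hermite_gauss n \<xi> = hermite_gauss (Suc (Suc n)) \<xi>"
    unfolding S poly_gauss_diff poly_gauss_mult pd poly_gauss_smult P_def[symmetric] by simp
  finally show ?case .
qed

section \<open>Poisson summation\<close>

lemma symmetric_sums:
  assumes "(f has_sum s) (UNIV :: int set)"
  shows "(\<lambda>N. \<Sum>k\<in>{- int N..int N}. f k) \<longlonglongrightarrow> s"
proof -
  have "filterlim (\<lambda>N. {- int N..int N}) (finite_subsets_at_top UNIV) sequentially"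
    unfolding filterlim_finite_subsets_at_top
  proof (intro allI impI)
    fix X :: "int set" assume X: "finite X \<and> X \<subseteq> UNIV"
    then have "bdd_above (abs ` X)" by simp
    then obtain b where b: "\<And>x. x \<in> X \<Longrightarrow> \<bar>x\<bar> \<le> b" by (auto simp: bdd_above_def)
    have "X \<subseteq> {- int N..int N}" if "N \<ge> nat b" for N
      using that b by (force simp: abs_le_iff)
    then show "\<forall>\<^sub>F N in sequentially. finite {- int N..int N} \<and> X \<subseteq> {- int N..int N} \<and> {- int N..int N} \<subseteq> UNIV"
      by (auto simp: eventually_sequentially intro!: exI[of _ "nat b"])
  qed
  with assms show ?thesis unfolding has_sum_def by (rule filterlim_compose)
qed

lemma sin_ge_half:
  fixes y :: real
  assumes "0 \<le> y" "y \<le> pi / 2"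
  shows "y / 2 \<le> sin y"
proof -
  have "\<bar>sin y - (\<Sum>m<3. sin_coeff m * y ^ m)\<bar> \<le> inverse (fact 3) * \<bar>y\<bar> ^ 3"
    by (rule Maclaurin_sin_bound)
  moreover have "(\<Sum>m<3. sin_coeff m * y ^ m) = y"
    unfolding numeral_3_eq_3 by (simp add: sin_coeff_def)
  moreover have "inverse (fact 3) * \<bar>y\<bar> ^ 3 = y ^ 3 / 6"
    using assms(1) by (simp add: fact_numeral)
  ultimately have "\<bar>sin y - y\<bar> \<le> y ^ 3 / 6" by simp
  then have 1: "sin y \<ge> y - y ^ 3 / 6" unfolding abs_le_iff by linarith
  have "y \<le> 8/5" using assms pi_approx by simp
  then have "y\<^sup>2 \<le> (8/5)\<^sup>2" using assms by (intro power_mono) auto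
  then have "y * y\<^sup>2 \<le> y * 3" using assms by (intro mult_left_mono) (auto simp: power2_eq_square)
  then have "y ^ 3 \<le> 3 * y" by (simp add: power2_eq_square power3_eq_cube)
  with 1 show ?thesis by linarith
qed

lemma cmod_cis_minus_1_ge:
  assumes "\<bar>x\<bar> \<le> 1/2"
  shows "\<bar>x\<bar> \<le> cmod (cis (2 * pi * x) - 1)"
proof -
  have "(cmod (cis (2 * pi * x) - 1))\<^sup>2 = (2 * sin (pi * x))\<^sup>2"
  proof -
    have c: "cos (2 * pi * x) = 1 - 2 * (sin (pi * x))\<^sup>2" using cos_double_sin[of "pi * x"] by (simp add: mult_ac)
    have "(cmod (cis (2 * pi * x) - 1))\<^sup>2 = (cos (2 * pi * x) - 1)\<^sup>2 + (sin (2 * pi * x))\<^sup>2"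
      by (simp add: cmod_power2)
    also have "\<dots> = 2 - 2 * cos (2 * pi * x)"
      using sin_cos_squared_add[of "2 * pi * x"] by (simp add: power2_eq_square algebra_simps)
    finally show ?thesis by (simp add: c power_mult_distrib)
  qed
  then have eq: "cmod (cis (2 * pi * x) - 1) = \<bar>2 * sin (pi * x)\<bar>"
    by (metis norm_ge_zero real_sqrt_abs abs_of_nonneg)
  have "pi * \<bar>x\<bar> / 2 \<le> sin (pi * \<bar>x\<bar>)" using assms by (intro sin_ge_half) auto
  moreover have "\<bar>x\<bar> \<le> pi * \<bar>x\<bar>" using pi_gt3 by (simp add: mult_le_cancel_right1)
  moreover have "\<bar>sin (pi * x)\<bar> = \<bar>sin (pi * \<bar>x\<bar>)\<bar>" by (cases "x \<ge> 0") auto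
  ultimately show ?thesis unfolding eq by linarith
qed

lemma riemann_lebesgue_bounded:
  fixes G :: "real \<Rightarrow> complex" and m :: "nat \<Rightarrow> int"
  assumes G: "G \<in> borel_measurable borel" "\<And>y. norm (G y) \<le> K" and m: "inj m"
  shows "(\<lambda>j. LINT y|lborel. indicator {a..a + 1} y *\<^sub>R (cis (- (2 * pi * of_int (m j) * y)) * G y)) \<longlonglongrightarrow> 0"
proof -
  define c where "c k = (LINT y|lborel. indicator {a..a + 1} y *\<^sub>R (cis (- (2 * pi * of_int k * y)) * G y))" for k :: int
  define E where "E = (LINT y|lborel. indicator {a..a + 1} y *\<^sub>R (cmod (G y))\<^sup>2)"
  have "(\<Sum>j<n. (cmod (c (m j)))\<^sup>2) \<le> E" for n
  proof -
    have "(\<Sum>j<n. (cmod (c (m j)))\<^sup>2) = (\<Sum>k\<in>m ` {..<n}. (cmod (c k))\<^sup>2)"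
      using m by (subst sum.reindex) (auto intro: inj_on_subset)
    also have "\<dots> \<le> E"
      using bessel_inequality[of 1 "m ` {..<n}" G K a] G by (simp add: c_def E_def)
    finally show ?thesis .
  qed
  then have "summable (\<lambda>j. (cmod (c (m j)))\<^sup>2)" by (intro summableI_nonneg_bounded[of _ E]) auto
  then have "(\<lambda>j. (cmod (c (m j)))\<^sup>2) \<longlonglongrightarrow> 0" by (rule summable_LIMSEQ_zero)
  then have "(\<lambda>j. cmod (c (m j))) \<longlonglongrightarrow> 0" by simp
  then show ?thesis unfolding c_def by (rule tendsto_norm_zero_cancel)
qed

text \<open>The bound on the derivative makes the periodization Lipschitz continuous at 0, which is what pointwise convergence of its Fourier series requires.\<close>

locale poisson_fun =
  fixes f f' :: "real \<Rightarrow> complex" and C C' :: real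
  assumes f_decays: "decays f C" and f'_decays: "decays f' C'"
    and f_deriv: "\<And>x. (f has_vector_derivative f' x) (at x)"
begin

lemma f_cont: "continuous_on S f"
  using f_deriv by (meson continuous_on_vector_derivative has_vector_derivative_at_within)

lemma f_measurable [measurable]: "f \<in> borel_measurable borel"
  by (intro borel_measurable_continuous_onI f_cont)

definition W :: real where "W = (\<Sum>\<^sub>\<infinity>p. weight p)"


text \<open>The constant 25 is \<open>(1 + 2 (1 + Y\<^sup>2) / a\<^sup>2)\<^sup>2\<close> for \<open>a = Y = 1\<close>.\<close>

lemma near_bound:
  fixes h :: "real \<Rightarrow> complex"
  assumes "decays h D" "\<bar>x\<bar> \<le> 1"
  shows "norm (h (x + of_int k)) \<le> D * 25 * weight k"
  using decays_lattice[OF assms(1) _ order.refl assms(2), of 1 k] by (simp add: weight_def)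

definition periodization :: "real \<Rightarrow> complex" where
  "periodization x = (\<Sum>\<^sub>\<infinity>k\<in>(UNIV::int set). f (x + of_int k))"

lemma periodization_has_sum: "((\<lambda>k::int. f (x + of_int k)) has_sum periodization x) UNIV"
  unfolding periodization_def
  using has_sum_infsum[OF abs_summable_summable[OF decays_summable[OF f_decays, of 1 x]]] by simp

lemma periodization_limit: "(\<lambda>N. \<Sum>k\<in>{- int N..int N}. f (x + of_int k)) \<longlonglongrightarrow> periodization x"
  by (rule symmetric_sums[OF periodization_has_sum])

lemma periodization_measurable [measurable]: "periodization \<in> borel_measurable borel"
  by (rule borel_measurable_LIMSEQ_metric[OF _ periodization_limit]) measurable

lemma W_has_sum: "(weight has_sum W) UNIV" unfolding W_def by (rule has_sum_infsum[OF weight_summable])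

lemma periodization_lipschitz:
  assumes "\<bar>x\<bar> \<le> 1"
  shows "norm (periodization x - periodization 0) \<le> C' * 25 * W * \<bar>x\<bar>"
proof -
  have d: "norm (f (x + of_int k) - f (of_int k)) \<le> C' * 25 * weight k * \<bar>x\<bar>" for k :: int
  proof -
    let ?S = "{of_int k - 1..of_int k + 1 :: real}"
    have "norm (f (x + of_int k) - f (of_int k)) \<le> C' * 25 * weight k * norm (x + of_int k - of_int k)"
    proof (rule differentiable_bound[where S = ?S and f' = "\<lambda>y h. h *\<^sub>R f' y"])
      fix y assume y: "y \<in> ?S"
      show "(f has_derivative (\<lambda>h. h *\<^sub>R f' y)) (at y within ?S)"
        using f_deriv[of y] by (simp add: has_vector_derivative_def has_derivative_at_withinI)
      have "norm (f' ((y - of_int k) + of_int k)) \<le> C' * 25 * weight k"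
        by (rule near_bound[OF f'_decays]) (use y in auto)
      then show "onorm (\<lambda>h. h *\<^sub>R f' y) \<le> C' * 25 * weight k"
        using decays_nonneg[OF f'_decays] weight_nonneg
        by (intro onorm_bound) (auto simp: mult.commute intro!: mult_left_mono)
    qed (use assms in auto)
    then show ?thesis by simp
  qed
  have "((\<lambda>k::int. f (x + of_int k) + - f (0 + of_int k)) has_sum (periodization x + - periodization 0)) UNIV"
    using periodization_has_sum by (intro has_sum_add) (simp_all only: has_sum_uminus minus_minus)
  moreover have "((\<lambda>k. C' * 25 * \<bar>x\<bar> * weight k) has_sum (C' * 25 * \<bar>x\<bar> * W)) UNIV"
    by (intro has_sum_cmult_right W_has_sum)
  ultimately have "norm (periodization x + - periodization 0) \<le> C' * 25 * \<bar>x\<bar> * W"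
    by (rule norm_infsum_le) (use d in \<open>simp add: mult_ac\<close>)
  then show ?thesis by (simp add: mult_ac)
qed

lemma partial_sum_bound:
  assumes "\<bar>x\<bar> \<le> 1" "finite X"
  shows "norm (\<Sum>k\<in>X. f (x + of_int k)) \<le> C * 25 * W"
proof -
  have "norm (\<Sum>k\<in>X. f (x + of_int k)) \<le> (\<Sum>k\<in>X. C * 25 * weight k)"
    by (intro sum_norm_le near_bound[OF f_decays] assms)
  also have "\<dots> = C * 25 * sum weight X" by (simp add: sum_distrib_left)
  also have "\<dots> \<le> C * 25 * W"
    unfolding W_def using decays_nonneg[OF f_decays] weight_nonneg
    by (intro mult_left_mono finite_sum_le_infsum weight_summable assms) auto
  finally show ?thesis .
qed

text \<open>The line is cut into the unit intervals \<open>J k\<close> centred at the integers, and these are moved to \<open>J 0\<close>. Dominated convergence is applied on either side of the resulting identity of finite sums.\<close>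

lemma fourier_periodization:
  "fourier f (of_int m) = (LINT x|lborel. indicator {-1/2..1/2} x *\<^sub>R (cis (- (2 * pi * of_int m * x)) * periodization x))"
proof -
  define e where "e x = cis (- (2 * pi * of_int m * x))" for x
  have e_norm [simp]: "norm (e x) = 1" for x by (simp add: e_def)
  have e_per: "e (x + of_int k) = e x" for x and k :: int
  proof -
    have "- (2 * pi * of_int m * (x + of_int k)) = - (2 * pi * of_int m * x) + 2 * pi * of_int (- m * k)"
      by (simp add: algebra_simps)
    then have "e (x + of_int k) = e x * cis (2 * pi * of_int (- m * k))"
      by (simp only: e_def cis_mult)
    also have "cis (2 * pi * of_int (- m * k)) = 1" by (rule cis_multiple_2pi) simp
    finally show ?thesis by simp
  qed
  have e_meas [measurable]: "e \<in> borel_measurable borel" unfolding e_def [abs_def] by measurable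
  define J where "J k = {of_int k - 1/2..<of_int k + 1/2 :: real}" for k :: int
  have [measurable]: "J k \<in> sets borel" for k by (simp add: J_def)
  have ef: "integrable lborel (\<lambda>x. e x * f x)"
    unfolding e_def by (rule decays_integrable[OF decays_cis[OF f_decays]]) measurable
  have J_int: "integrable lborel (\<lambda>x. indicator (J k) x *\<^sub>R (e x * f x))" for k
    by (rule integrable_mult_indicator[OF _ ef]) (simp add: J_def)
  have mem: "x \<in> J k \<longleftrightarrow> \<lfloor>x + 1/2\<rfloor> = k" for x k
    unfolding J_def floor_eq_iff by auto
  have lim1: "(\<lambda>N. LINT x|lborel. (\<Sum>k\<in>{- int N..int N}. indicator (J k) x *\<^sub>R (e x * f x))) \<longlonglongrightarrow> (LINT x|lborel. e x * f x)"
  proof (rule integral_dominated_convergence)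
    have sum_eq: "(\<Sum>k\<in>{- int N..int N}. indicator (J k) x *\<^sub>R (e x * f x))
        = (if \<lfloor>x + 1/2\<rfloor> \<in> {- int N..int N} then e x * f x else 0)" for N x
    proof -
      have "(\<Sum>k\<in>{- int N..int N}. indicator (J k) x *\<^sub>R (e x * f x))
          = (\<Sum>k\<in>{- int N..int N}. if \<lfloor>x + 1/2\<rfloor> = k then e x * f x else 0)"
        by (intro sum.cong refl) (simp add: indicator_def mem)
      then show ?thesis by simp
    qed
    show "integrable lborel (\<lambda>x. norm (e x * f x))" using ef by (rule integrable_norm)
    show "AE x in lborel. norm (\<Sum>k\<in>{- int N..int N}. indicator (J k) x *\<^sub>R (e x * f x)) \<le> norm (e x * f x)" for N
      unfolding sum_eq by simp
    show "AE x in lborel. (\<lambda>N. \<Sum>k\<in>{- int N..int N}. indicator (J k) x *\<^sub>R (e x * f x)) \<longlonglongrightarrow> e x * f x"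
    proof (intro AE_I2 tendsto_eventually)
      fix x :: real
      have "\<lfloor>x + 1/2\<rfloor> \<in> {- int N..int N}" if "N \<ge> nat \<bar>\<lfloor>x + 1/2\<rfloor>\<bar>" for N using that by auto
      then show "\<forall>\<^sub>F N in sequentially. (\<Sum>k\<in>{- int N..int N}. indicator (J k) x *\<^sub>R (e x * f x)) = e x * f x"
        unfolding sum_eq eventually_sequentially by (intro exI[of _ "nat \<bar>\<lfloor>x + 1/2\<rfloor>\<bar>"]) auto
    qed
    show "(\<lambda>x. e x * f x) \<in> borel_measurable lborel" using ef by (rule borel_measurable_integrable)
    show "(\<lambda>x. \<Sum>k\<in>{- int N..int N}. indicator (J k) x *\<^sub>R (e x * f x)) \<in> borel_measurable lborel" for N
      by (intro borel_measurable_sum borel_measurable_integrable[OF J_int])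
  qed
  have bd_int: "integrable lborel (\<lambda>x. indicator (J 0) x *\<^sub>R h x)"
    if "h \<in> borel_measurable borel" "\<And>x. x \<in> J 0 \<Longrightarrow> norm (h x) \<le> K" for h :: "real \<Rightarrow> complex" and K
    by (rule integrableI_bounded_set_indicator[where B = K]) (use that in \<open>auto simp: J_def\<close>)
  have J0: "\<bar>x\<bar> \<le> 1" if "x \<in> J 0" for x using that by (auto simp: J_def)
  have shift: "(LINT x|lborel. (\<Sum>k\<in>{- int N..int N}. indicator (J k) x *\<^sub>R (e x * f x)))
      = (LINT x|lborel. indicator (J 0) x *\<^sub>R (e x * (\<Sum>k\<in>{- int N..int N}. f (x + of_int k))))" for N
  proof -
    have "(LINT x|lborel. (\<Sum>k\<in>{- int N..int N}. indicator (J k) x *\<^sub>R (e x * f x)))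
      = (\<Sum>k\<in>{- int N..int N}. LINT x|lborel. indicator (J k) x *\<^sub>R (e x * f x))"
      by (rule Bochner_Integration.integral_sum) (rule J_int)
    also have "\<dots> = (\<Sum>k\<in>{- int N..int N}. LINT x|lborel. indicator (J 0) x *\<^sub>R (e x * f (x + of_int k)))"
    proof (intro sum.cong refl)
      fix k
      have "indicator (J k) (of_int k + 1 * x) = (indicator (J 0) x :: real)" for x
        by (auto simp: J_def indicator_def)
      then show "(LINT x|lborel. indicator (J k) x *\<^sub>R (e x * f x)) = (LINT x|lborel. indicator (J 0) x *\<^sub>R (e x * f (x + of_int k)))"
        by (subst lborel_integral_real_affine[where c = 1 and t = "of_int k"])
           (simp_all add: add.commute[of "of_int k"] e_per)
    qed
    also have "\<dots> = (LINT x|lborel. (\<Sum>k\<in>{- int N..int N}. indicator (J 0) x *\<^sub>R (e x * f (x + of_int k))))"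
    proof (rule Bochner_Integration.integral_sum[symmetric])
      fix k
      show "integrable lborel (\<lambda>x. indicator (J 0) x *\<^sub>R (e x * f (x + of_int k)))"
        by (rule bd_int[where K = C], measurable) (simp add: norm_mult decays_le[OF f_decays])
    qed
    finally show ?thesis by (simp only: sum_distrib_left scaleR_sum_right)
  qed
  have lim2: "(\<lambda>N. LINT x|lborel. indicator (J 0) x *\<^sub>R (e x * (\<Sum>k\<in>{- int N..int N}. f (x + of_int k))))
      \<longlonglongrightarrow> (LINT x|lborel. indicator (J 0) x *\<^sub>R (e x * periodization x))"
  proof (rule integral_dominated_convergence)
    show "integrable lborel (\<lambda>x. indicator (J 0) x *\<^sub>R (C * 25 * W))"
      by (rule integrableI_bounded_set_indicator[where B = "\<bar>C * 25 * W\<bar>"]) (auto simp: J_def)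
    show "AE x in lborel. norm (indicator (J 0) x *\<^sub>R (e x * (\<Sum>k\<in>{- int N..int N}. f (x + of_int k)))) \<le> indicator (J 0) x *\<^sub>R (C * 25 * W)" for N
      using partial_sum_bound[OF J0] by (intro AE_I2) (auto simp: norm_mult indicator_def)
    show "AE x in lborel. (\<lambda>N. indicator (J 0) x *\<^sub>R (e x * (\<Sum>k\<in>{- int N..int N}. f (x + of_int k))))
        \<longlonglongrightarrow> indicator (J 0) x *\<^sub>R (e x * periodization x)"
      by (intro AE_I2 tendsto_intros periodization_limit)
  qed measurable
  have "(LINT x|lborel. e x * f x) = (LINT x|lborel. indicator (J 0) x *\<^sub>R (e x * periodization x))"
    by (rule LIMSEQ_unique[OF lim1[unfolded shift] lim2])
  also have "\<dots> = (LINT x|lborel. indicator {-1/2..1/2} x *\<^sub>R (e x * periodization x))"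
  proof (rule integral_cong_AE)
    have "AE x in lborel. x \<noteq> (1/2::real)" by (rule AE_lborel_singleton)
    then show "AE x in lborel. indicator (J 0) x *\<^sub>R (e x * periodization x) = indicator {-1/2..1/2} x *\<^sub>R (e x * periodization x)"
      by eventually_elim (auto simp: J_def indicator_def)
  qed measurable
  finally show ?thesis by (simp add: fourier_def e_def)
qed

text \<open>Chernoff's argument for pointwise convergence: with \<open>\<phi>\<close> the periodization, write \<open>\<phi> x = \<phi> 0 + G x (exp (2 \<pi> \<i> x) - 1)\<close>. The quotient \<open>G\<close> is bounded since \<open>\<phi>\<close> is Lipschitz at 0, and the symmetric partial sums of the Fourier series of \<open>\<phi>\<close> telescope to \<open>\<phi> 0\<close> plus two Fourier coefficients of \<open>G\<close>, which tend to 0 by Bessel's inequality.\<close>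

theorem poisson: "(\<lambda>N. \<Sum>m\<in>{- int N..int N}. fourier f (of_int m)) \<longlonglongrightarrow> (\<Sum>\<^sub>\<infinity>k\<in>(UNIV::int set). f (of_int k))"
proof -
  define \<phi>0 where "\<phi>0 = periodization 0"
  define G where "G x = indicator {-1/2..1/2} x *\<^sub>R ((periodization x - \<phi>0) / (cis (2 * pi * x) - 1))" for x
  have [measurable]: "G \<in> borel_measurable borel" unfolding G_def [abs_def] by measurable
  have G_bd: "norm (G x) \<le> C' * 25 * W" for x
  proof (cases "x \<in> {-1/2..1/2}")
    case True
    then have x: "\<bar>x\<bar> \<le> 1/2" by auto
    have "norm (periodization x - \<phi>0) \<le> C' * 25 * W * \<bar>x\<bar>"
      unfolding \<phi>0_def by (rule periodization_lipschitz) (use x in simp)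
    also have "\<dots> \<le> C' * 25 * W * cmod (cis (2 * pi * x) - 1)"
      using decays_nonneg[OF f'_decays] weight_nonneg unfolding W_def
      by (intro mult_left_mono cmod_cis_minus_1_ge[OF x] mult_nonneg_nonneg infsum_nonneg) auto
    finally have le: "norm (periodization x - \<phi>0) \<le> C' * 25 * W * cmod (cis (2 * pi * x) - 1)" .
    have "G x = (periodization x - \<phi>0) / (cis (2 * pi * x) - 1)"
      using True unfolding G_def by (simp only: indicator_simps scaleR_one)
    then have eq: "norm (G x) = norm (periodization x - \<phi>0) / cmod (cis (2 * pi * x) - 1)"
      by (simp only: norm_divide)
    show ?thesis
    proof (cases "cis (2 * pi * x) = 1")
      case False
      then have "cmod (cis (2 * pi * x) - 1) > 0" by simp
      with le show ?thesis unfolding eq by (simp only: pos_divide_le_eq)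
    next
      case True
      then show ?thesis
        unfolding eq using decays_nonneg[OF f'_decays] infsum_nonneg[of UNIV weight] weight_nonneg by (simp add: W_def)
    qed
  next
    case False
    then show ?thesis using decays_nonneg[OF f'_decays] infsum_nonneg[of UNIV weight] weight_nonneg by (simp add: G_def W_def)
  qed
  have G_eq: "periodization x = \<phi>0 + G x * (cis (2 * pi * x) - 1)" if "x \<in> {-1/2..1/2}" for x
  proof (cases "x = 0")
    case False
    have "\<bar>x\<bar> \<le> 1/2" using that unfolding abs_le_iff by auto
    then have "cis (2 * pi * x) - 1 \<noteq> 0" using cmod_cis_minus_1_ge[of x] False by auto
    moreover have "G x = (periodization x - \<phi>0) / (cis (2 * pi * x) - 1)"
      using that unfolding G_def by (simp only: indicator_simps scaleR_one)
    ultimately show ?thesis by simp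
  qed (simp add: \<phi>0_def)
  define c where "c m = (LINT x|lborel. indicator {-1/2..1/2} x *\<^sub>R (cis (- (2 * pi * of_int m * x)) * G x))" for m :: int
  have c_int: "integrable lborel (\<lambda>x. indicator {-1/2..1/2} x *\<^sub>R (cis (- (2 * pi * of_int m * x)) * G x))" for m :: int
    by (rule integrableI_bounded_set_indicator[where B = "C' * 25 * W"]) (use G_bd in \<open>auto simp: norm_mult\<close>)
  have e_int: "integrable lborel (\<lambda>x. indicator {-1/2..1/2} x *\<^sub>R (cis (- (2 * pi * of_int m * x)) * \<phi>0))" for m :: int
    by (rule integrableI_bounded_set_indicator[where B = "norm \<phi>0"]) (auto simp: norm_mult)
  have coef: "fourier f (of_int m) = (if m = 0 then \<phi>0 else 0) + c (m - 1) - c m" for m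
  proof -
    have "fourier f (of_int m) = (LINT x|lborel. indicator {-1/2..1/2} x *\<^sub>R (cis (- (2 * pi * of_int m * x)) * \<phi>0)
        + indicator {-1/2..1/2} x *\<^sub>R (cis (- (2 * pi * of_int (m - 1) * x)) * G x)
        - indicator {-1/2..1/2} x *\<^sub>R (cis (- (2 * pi * of_int m * x)) * G x))"
      unfolding fourier_periodization
    proof (intro Bochner_Integration.integral_cong refl)
      fix x
      have "- (2 * pi * of_int (m - 1) * x) = - (2 * pi * of_int m * x) + 2 * pi * x" by (simp add: algebra_simps)
      then have e: "cis (- (2 * pi * of_int (m - 1) * x)) = cis (- (2 * pi * of_int m * x)) * cis (2 * pi * x)"
        by (simp only: cis_mult)
      show "indicator {-1/2..1/2} x *\<^sub>R (cis (- (2 * pi * of_int m * x)) * periodization x)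
         = indicator {-1/2..1/2} x *\<^sub>R (cis (- (2 * pi * of_int m * x)) * \<phi>0)
        + indicator {-1/2..1/2} x *\<^sub>R (cis (- (2 * pi * of_int (m - 1) * x)) * G x)
        - indicator {-1/2..1/2} x *\<^sub>R (cis (- (2 * pi * of_int m * x)) * G x)"
      proof (cases "x \<in> {-1/2..1/2}")
        case True
        show ?thesis unfolding e by (subst G_eq[OF True]) (simp add: algebra_simps)
      next
        case False
        then have i0: "indicator {-1/2..1/2} x = (0 :: real)" by (simp add: indicator_def)
        show ?thesis unfolding i0 by simp
      qed
    qed
    also have "\<dots> = (LINT x|lborel. indicator {-1/2..1/2} x *\<^sub>R (cis (- (2 * pi * of_int m * x)) * \<phi>0)) + c (m - 1) - c m"
      unfolding c_def
      by (subst Bochner_Integration.integral_diff[OF Bochner_Integration.integrable_add[OF e_int c_int[of "m - 1"]] c_int])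
         (subst Bochner_Integration.integral_add[OF e_int c_int[of "m - 1"]], rule refl)
    also have "(LINT x|lborel. indicator {-1/2..1/2} x *\<^sub>R (cis (- (2 * pi * of_int m * x)) * \<phi>0)) = (if m = 0 then \<phi>0 else 0)"
      using integral_cis_period[of 1 "-1/2" "- m"]
      by (simp flip: mult_scaleR_left)
    finally show ?thesis .
  qed
  have tele: "(\<Sum>m\<in>{- int N..int N}. fourier f (of_int m)) = \<phi>0 + c (- int N - 1) - c (int N)" for N
  proof (induction N)
    case (Suc N)
    have "{- int (Suc N)..int (Suc N)} = insert (- int (Suc N)) (insert (int (Suc N)) {- int N..int N})" by auto
    then have step: "(\<Sum>m\<in>{- int (Suc N)..int (Suc N)}. fourier f (of_int m))
       = fourier f (of_int (- int (Suc N))) + fourier f (of_int (int (Suc N))) + (\<Sum>m\<in>{- int N..int N}. fourier f (of_int m))"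
      by (simp add: add.assoc)
    have ix: "- 1 - int N = - int N - 1" by simp
    show ?case unfolding step Suc.IH coef[of "- int (Suc N)"] coef[of "int (Suc N)"] by (simp add: ix)
  qed (simp only: coef of_nat_0, simp add: coef[of 0, simplified])
  have "(\<lambda>N. c (int N)) \<longlonglongrightarrow> 0" "(\<lambda>N. c (- int N - 1)) \<longlonglongrightarrow> 0"
    unfolding c_def using riemann_lebesgue_bounded[of G "C' * 25 * W" "\<lambda>N. int N" "-1/2"]
      riemann_lebesgue_bounded[of G "C' * 25 * W" "\<lambda>N. - int N - 1" "-1/2"] G_bd
    by (simp_all add: inj_def)
  then have "(\<lambda>N. \<phi>0 + c (- int N - 1) - c (int N)) \<longlonglongrightarrow> \<phi>0 + 0 - 0"
    by (intro tendsto_intros)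
  then show ?thesis unfolding tele \<phi>0_def periodization_def by simp
qed

end

section \<open>The two Gabor systems\<close>

lemma decays_compose_affine:
  assumes f: "decays f C" and lam: "lam > 0"
  shows "\<exists>D. decays (\<lambda>x. f (y + lam * x)) D"
proof
  show "decays (\<lambda>x. f (y + lam * x)) (C * (1 + 2 * (1 + \<bar>y\<bar>\<^sup>2) / lam\<^sup>2)\<^sup>2)"
    unfolding decays_def
  proof
    fix x
    show "norm (f (y + lam * x)) * (1 + x\<^sup>2) ^ 2 \<le> C * (1 + 2 * (1 + \<bar>y\<bar>\<^sup>2) / lam\<^sup>2)\<^sup>2"
      using decays_affine[OF f lam order.refl order.refl, of y x]
      by (subst (asm) pos_le_divide_eq) (simp_all add: zero_less_power)
  qed
qed

lemma decays_mult: "decays f C \<Longrightarrow> decays (\<lambda>x. c * f x) (norm c * C)" for f :: "real \<Rightarrow> complex"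
  by (simp add: decays_def norm_mult mult_left_mono mult.assoc)

lemma fourier_affine:
  assumes lam: "lam > 0"
  shows "fourier (\<lambda>x. f (y + lam * x)) \<xi> = cis (2 * pi * \<xi> * y / lam) / lam * fourier f (\<xi> / lam)"
proof -
  have "fourier f (\<xi> / lam) = \<bar>lam\<bar> *\<^sub>R (LINT x|lborel. cis (- (2 * pi * (\<xi> / lam) * (y + lam * x))) * f (y + lam * x))"
    unfolding fourier_def by (rule lborel_integral_real_affine) (use lam in simp)
  also have "\<dots> = lam * (LINT x|lborel. cis (- (2 * pi * \<xi> * y / lam)) * (cis (- (2 * pi * \<xi> * x)) * f (y + lam * x)))"
  proof -
    have "cis (- (2 * pi * (\<xi> / lam) * (y + lam * x))) = cis (- (2 * pi * \<xi> * y / lam)) * cis (- (2 * pi * \<xi> * x))" for x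
    proof -
      have "- (2 * pi * (\<xi> / lam) * (y + lam * x)) = - (2 * pi * \<xi> * y / lam) + - (2 * pi * \<xi> * x)"
        using lam by (simp add: field_simps)
      then show ?thesis by (simp only: cis_mult)
    qed
    then show ?thesis using lam by (simp add: mult.assoc scaleR_conv_of_real)
  qed
  also have "\<dots> = lam * (cis (- (2 * pi * \<xi> * y / lam)) * fourier (\<lambda>x. f (y + lam * x)) \<xi>)"
    by (simp add: fourier_def)
  finally have eq: "fourier f (\<xi> / lam) = lam * (cis (- (2 * pi * \<xi> * y / lam)) * fourier (\<lambda>x. f (y + lam * x)) \<xi>)" .
  have "cis (2 * pi * \<xi> * y / lam) * cis (- (2 * pi * \<xi> * y / lam)) = 1" by (simp add: cis_mult)
  moreover have "cis (2 * pi * \<xi> * y / lam) / lam * fourier f (\<xi> / lam)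
     = (cis (2 * pi * \<xi> * y / lam) * cis (- (2 * pi * \<xi> * y / lam))) * fourier (\<lambda>x. f (y + lam * x)) \<xi>"
    unfolding eq using lam by simp
  ultimately show ?thesis by simp
qed

lemma lattice_sum_has_sum:
  assumes "decays u C" "lam > 0"
  shows "((\<lambda>k::int. complex_of_real (u (lam / 6 + lam * of_int k))) has_sum of_real (lattice_sum u lam)) UNIV"
proof -
  have "((\<lambda>k::int. u (lam / 6 + lam * of_int k)) has_sum (\<Sum>\<^sub>\<infinity>k\<in>(UNIV::int set). u (lam / 6 + lam * of_int k))) UNIV"
    by (rule has_sum_infsum[OF abs_summable_summable[OF decays_summable[OF assms]]])
  moreover have "(\<Sum>\<^sub>\<infinity>k\<in>(UNIV::int set). u (lam / 6 + lam * of_int k)) = lattice_sum u lam"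
    unfolding lattice_sum_def by (intro infsum_cong arg_cong[of _ _ u]) (simp add: distrib_left)
  ultimately show ?thesis by (simp only: has_sum_of_real)
qed

text \<open>Poisson summation for \<open>x \<mapsto> hermite_gauss n (lam (x + 1/6))\<close>. The shift by 1/6 turns into the phases \<open>cis (\<pi> m / 3)\<close>, and the eigenvalue \<open>(- \<i>)\<^sup>n\<close> does not vanish.\<close>

lemma hermite_poisson_zero:
  assumes lam: "lam > 0" and zero: "lattice_sum (hermite_gauss n) lam = 0"
  shows "((\<lambda>m. cis (pi / 3 * of_int m) * of_real (hermite_gauss n (of_int m / lam))) has_sum 0) (UNIV :: int set)"
proof -
  define u where "u x = complex_of_real (hermite_gauss n x)" for x
  define u' where "u' x = complex_of_real (hermite_gauss' n x)" for x
  obtain D where D: "decays u D" unfolding u_def [abs_def] using poly_gauss_decays by blast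
  obtain D' where D': "decays u' D'" unfolding u'_def [abs_def] hermite_gauss'_def using poly_gauss_decays by blast
  obtain E where E: "decays (\<lambda>x. u (lam / 6 + lam * x)) E" using decays_compose_affine[OF D lam] by blast
  obtain E' where E': "decays (\<lambda>x. u' (lam / 6 + lam * x)) E'" using decays_compose_affine[OF D' lam] by blast
  have E'': "decays (\<lambda>x. of_real lam * u' (lam / 6 + lam * x)) (norm (complex_of_real lam) * E')"
    by (rule decays_mult[OF E'])
  have deriv: "((\<lambda>x. u (lam / 6 + lam * x)) has_vector_derivative of_real lam * u' (lam / 6 + lam * x)) (at x)" for x
  proof -
    have "((\<lambda>x. hermite_gauss n (lam / 6 + lam * x)) has_real_derivative hermite_gauss' n (lam / 6 + lam * x) * lam) (at x)"
      by (rule DERIV_chain2[OF hermite_gauss_has_deriv]) (auto intro!: derivative_eq_intros)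
    from has_vector_derivative_of_real[OF this] show ?thesis
      by (simp add: u_def u'_def mult.commute)
  qed
  interpret poisson_fun "\<lambda>x. u (lam / 6 + lam * x)" "\<lambda>x. of_real lam * u' (lam / 6 + lam * x)" E "norm (complex_of_real lam) * E'"
    by unfold_locales (rule E E'' deriv)+
  obtain Ch where "decays (hermite_gauss n) Ch" using hermite_gauss_decays by blast
  from infsumI[OF lattice_sum_has_sum[OF this lam]]
  have "(\<Sum>\<^sub>\<infinity>k\<in>(UNIV::int set). u (lam / 6 + lam * of_int k)) = 0"
    by (simp add: u_def zero)
  then have lim: "(\<lambda>N. \<Sum>m\<in>{- int N..int N}. fourier (\<lambda>x. u (lam / 6 + lam * x)) (of_int m)) \<longlonglongrightarrow> 0"
    using poisson by simp
  define c where "c = (- \<i>) ^ n / complex_of_real lam"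
  have c: "c \<noteq> 0" using lam by (simp add: c_def)
  define a where "a m = cis (pi / 3 * of_int m) * u (of_int m / lam)" for m :: int
  have "fourier (\<lambda>x. u (lam / 6 + lam * x)) (of_int m) = c * a m" for m
  proof -
    have ph: "2 * pi * of_int m * (lam / 6) / lam = pi / 3 * of_int m" using lam by simp
    have "fourier u (of_int m / lam) = (- \<i>) ^ n * u (of_int m / lam)"
      using fourier_hermite_gauss[of n "of_int m / lam"] by (simp add: u_def [abs_def])
    then show ?thesis
      unfolding fourier_affine[OF lam] ph by (simp add: a_def c_def)
  qed
  then have "(\<lambda>N. c * (\<Sum>m\<in>{- int N..int N}. a m)) \<longlonglongrightarrow> 0"
    using lim by (simp add: sum_distrib_left)
  from tendsto_mult[OF tendsto_const[of "inverse c"] this]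
  have 1: "(\<lambda>N. \<Sum>m\<in>{- int N..int N}. a m) \<longlonglongrightarrow> 0" using c by (simp flip: mult.assoc)
  have "(\<lambda>m::int. norm (a m)) summable_on UNIV"
    using decays_summable[OF D, of "1 / lam" 0] lam by (simp add: a_def norm_mult)
  then have s: "(a has_sum infsum a UNIV) UNIV" by (rule has_sum_infsum[OF abs_summable_summable])
  have "infsum a UNIV = 0" by (rule LIMSEQ_unique[OF symmetric_sums[OF s] 1])
  with s show ?thesis by (simp add: a_def [abs_def] u_def)
qed

lemma has_sum_mod3:
  fixes a :: "int \<Rightarrow> complex"
  assumes "\<And>j. j \<in> {0, 1, 2} \<Longrightarrow> ((\<lambda>l. a (3 * l - j)) has_sum s j) UNIV"
  shows "(a has_sum (s 0 + s 1 + s 2)) UNIV"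
proof -
  have r: "(a has_sum s j) (range (\<lambda>l. 3 * l - j))" if "j \<in> {0, 1, 2}" for j
    using assms[OF that] by (subst has_sum_reindex) (auto simp: inj_def o_def)
  have 01: "(a has_sum (s 0 + s 1)) (range (\<lambda>l. 3 * l - 0) \<union> range (\<lambda>l. 3 * l - 1))"
    by (intro has_sum_Un_disjoint r) (auto, presburger)
  have 012: "(a has_sum (s 0 + s 1 + s 2)) (range (\<lambda>l. 3 * l - 0) \<union> range (\<lambda>l. 3 * l - 1) \<union> range (\<lambda>l. 3 * l - 2))"
    by (intro has_sum_Un_disjoint 01 r) (auto, presburger+)
  have "m \<in> range (\<lambda>l. 3 * l - 0) \<union> range (\<lambda>l. 3 * l - 1) \<union> range (\<lambda>l. 3 * l - 2)" for m :: int
  proof -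
    have "(\<exists>l. m = 3 * l - 0) \<or> (\<exists>l. m = 3 * l - 1) \<or> (\<exists>l. m = 3 * l - 2)" by presburger
    then show ?thesis by blast
  qed
  then have "range (\<lambda>l. 3 * l - 0) \<union> range (\<lambda>l. 3 * l - 1) \<union> range (\<lambda>l. 3 * l - (2::int)) = UNIV" by blast
  with 012 show ?thesis by simp
qed

lemma has_sum_reflect:
  fixes a :: "int \<Rightarrow> complex"
  assumes "(a has_sum s) UNIV" "\<And>l. a (c - l) = e * b l"
  shows "((\<lambda>l. e * b l) has_sum s) UNIV"
proof -
  have "((\<lambda>l. a (c - l)) has_sum s) UNIV"
    using assms(1) by (subst has_sum_reindex_bij_betw[where g = "\<lambda>l. c - l" and B = UNIV and f = a, OF bij_betwI[of _ _ _ "\<lambda>l. c - l"]]) simp_all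
  then show ?thesis by (simp only: assms(2))
qed

lemma has_sum_antisymmetric_zero:
  fixes a :: "int \<Rightarrow> complex"
  assumes "(a has_sum s) UNIV" "\<And>l. a (c - l) = - a l"
  shows "s = 0"
proof -
  have "((\<lambda>l. -1 * a l) has_sum s) UNIV" by (rule has_sum_reflect[OF assms(1), where c = c]) (simp add: assms(2))
  moreover have "((\<lambda>l. -1 * a l) has_sum -1 * s) UNIV" using assms(1) by (rule has_sum_cmult_right)
  ultimately have "s = -1 * s" by (rule has_sum_unique)
  then show ?thesis by (simp add: complex_eq_iff)
qed

lemma cis_pi_int_uminus: "cis (pi * of_int (- l)) = cis (pi * of_int l)"
proof -
  have "pi * of_int (- l) + 2 * pi * of_int l = pi * of_int l" by simp
  then have "cis (pi * of_int (- l)) * cis (2 * pi * of_int l) = cis (pi * of_int l)"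
    by (simp only: cis_mult)
  moreover have "cis (2 * pi * of_int l) = 1" by (rule cis_multiple_2pi) simp
  ultimately show ?thesis by (simp only: mult_1_right)
qed

text \<open>For \<open>j = 1\<close> the sum is the reflection of the given one, and for \<open>j = 2\<close> its points \<open>lam (k - 1/2)\<close> are symmetric about 0.\<close>

lemma odd_window_not_frame:
  fixes h :: "real \<Rightarrow> complex"
  assumes h: "decays h C" "continuous_on UNIV h" and odd: "\<And>x. h (- x) = - h x" and lam: "lam > 0"
    and zero: "((\<lambda>k::int. h (lam / 6 + lam * of_int k)) has_sum 0) UNIV"
  shows "\<not> is_L2_frame (gabor_atom h (lam / 3) (1 / lam))"
proof -
  have s: "((\<lambda>k::int. h (y + lam * of_int k)) has_sum (\<Sum>\<^sub>\<infinity>k\<in>(UNIV::int set). h (y + lam * of_int k))) UNIV" for y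
    by (rule has_sum_infsum[OF abs_summable_summable[OF decays_summable[OF h(1) lam]]])
  have 1: "((\<lambda>k::int. -1 * h (lam / 6 - lam / 3 + lam * of_int k)) has_sum 0) UNIV"
  proof (rule has_sum_reflect[OF zero, where c = 0])
    fix l :: int
    have "lam / 6 + lam * of_int (0 - l) = - (lam / 6 - lam / 3 + lam * of_int l)" by (simp add: field_simps)
    then show "h (lam / 6 + lam * of_int (0 - l)) = -1 * h (lam / 6 - lam / 3 + lam * of_int l)"
      by (simp only: odd) simp
  qed
  have shift1: "((\<lambda>k::int. h (lam / 6 - lam / 3 + lam * of_int k)) has_sum 0) UNIV"
    using has_sum_cmult_right[OF 1, of "-1"] by simp
  have shift2: "(\<Sum>\<^sub>\<infinity>k\<in>(UNIV::int set). h (lam / 6 - lam / 3 * 2 + lam * of_int k)) = 0"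
  proof (rule has_sum_antisymmetric_zero[OF s, where c = 1])
    fix l :: int
    have "lam / 6 - lam / 3 * 2 + lam * of_int (1 - l) = - (lam / 6 - lam / 3 * 2 + lam * of_int l)" by (simp add: field_simps)
    then show "h (lam / 6 - lam / 3 * 2 + lam * of_int (1 - l)) = - h (lam / 6 - lam / 3 * 2 + lam * of_int l)"
      by (simp only: odd)
  qed
  interpret gabor_obstruction h lam "lam / 6" 0 C 3
  proof
    fix j :: nat assume "j < 3"
    then consider "j = 0" | "j = 1" | "j = 2" by linarith
    then show "(\<Sum>\<^sub>\<infinity>l\<in>(UNIV::int set). cis (0 * of_int l) * h (lam / 6 + lam * of_int l - lam / real 3 * real j)) = 0"
    proof cases
      case 1
      then show ?thesis using zero by (simp add: infsumI)
    next
      case 2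
      have "(\<lambda>l::int. h (lam / 6 - lam / 3 + lam * of_int l)) = (\<lambda>l. h (lam / 6 + lam * of_int l - lam / 3))"
        by (intro ext arg_cong[of _ _ h]) simp
      then show ?thesis using 2 infsumI[OF shift1] by simp
    next
      case 3
      have "(\<lambda>l::int. h (lam / 6 - lam / 3 * 2 + lam * of_int l)) = (\<lambda>l. h (lam / 6 + lam * of_int l - lam / 3 * 2))"
        by (intro ext arg_cong[of _ _ h]) simp
      with shift2 show ?thesis by (simp add: 3 del: times_divide_eq_left)
    qed
  qed (use h lam in simp_all)
  from not_frame show ?thesis by simp
qed

text \<open>With \<open>\<theta> = \<pi>\<close> the phases \<open>cis (\<theta> l)\<close> are the signs \<open>(-1)\<^sup>l\<close>, which is what remains of \<open>cis (\<pi> m / 3)\<close> on each residue class \<open>m = 3 l - j\<close>.\<close>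

lemma odd_window_not_frame_dual:
  fixes h :: "real \<Rightarrow> complex"
  assumes h: "decays h C" "continuous_on UNIV h" and odd: "\<And>x. h (- x) = - h x" and lam: "lam > 0"
    and zero: "((\<lambda>m::int. cis (pi / 3 * of_int m) * h (of_int m / lam)) has_sum 0) UNIV"
  shows "\<not> is_L2_frame (gabor_atom h (1 / lam) (lam / 3))"
proof -
  define mu where "mu = 3 / lam"
  have mu: "mu > 0" using lam by (simp add: mu_def)
  define r where "r j l = cis (pi * of_int l) * h (of_int (3 * l - j) / lam)" for j l :: int
  define R where "R j = (\<Sum>\<^sub>\<infinity>l. r j l)" for j
  have r: "(r j has_sum R j) UNIV" for j
  proof -
    have "(\<lambda>l::int. norm (h (- of_int j / lam + mu * of_int l))) summable_on UNIV"
      by (rule decays_summable[OF h(1) mu])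
    moreover have "norm (r j l) = norm (h (- of_int j / lam + mu * of_int l))" for l
    proof -
      have "- of_int j / lam + mu * of_int l = of_int (3 * l - j) / lam"
        by (simp add: mu_def diff_divide_distrib)
      then show ?thesis by (simp add: r_def norm_mult)
    qed
    ultimately have "(\<lambda>l. norm (r j l)) summable_on UNIV" by simp
    then show ?thesis unfolding R_def by (rule has_sum_infsum[OF abs_summable_summable])
  qed
  have R0: "R 0 = 0"
  proof (rule has_sum_antisymmetric_zero[OF r, where c = 0])
    fix l :: int
    have "of_int (3 * (0 - l) - 0) / lam = - (of_int (3 * l - 0) / lam)" by simp
    then have "h (of_int (3 * (0 - l) - 0) / lam) = - h (of_int (3 * l - 0) / lam)" by (simp only: odd)
    then show "r 0 (0 - l) = - r 0 l"
      unfolding r_def using cis_pi_int_uminus[of l] by simp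
  qed
  have R2: "R 2 = R 1"
  proof -
    have "((\<lambda>l. 1 * r 1 l) has_sum R 2) UNIV"
    proof (rule has_sum_reflect[OF r, where c = 1])
      fix l :: int
      have "of_int (3 * (1 - l) - 2) / lam = - (of_int (3 * l - 1) / lam)" using lam by (simp add: field_simps)
      then have "h (of_int (3 * (1 - l) - 2) / lam) = - h (of_int (3 * l - 1) / lam)" by (simp only: odd)
      moreover have "cis (pi * of_int (1 - l)) = - cis (pi * of_int l)"
      proof -
        have "pi * of_int (1 - l) = pi + pi * of_int (- l)" by (simp add: algebra_simps)
        then have "cis (pi * of_int (1 - l)) = cis pi * cis (pi * of_int (- l))" by (simp only: cis_mult)
        then show ?thesis by (simp only: cis_pi_int_uminus cis_pi) simp
      qed
      ultimately show "r 2 (1 - l) = 1 * r 1 l" unfolding r_def by simp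
    qed
    then show ?thesis using has_sum_unique[OF r[of 1]] by simp
  qed
  have "((\<lambda>m::int. cis (pi / 3 * of_int m) * h (of_int m / lam)) has_sum
      (cis (- (pi / 3) * of_int 0) * R 0 + cis (- (pi / 3) * of_int 1) * R 1 + cis (- (pi / 3) * of_int 2) * R 2)) UNIV"
  proof (rule has_sum_mod3[where s = "\<lambda>j. cis (- (pi / 3) * of_int j) * R j"])
    fix j :: int
    have "cis (pi / 3 * of_int (3 * l - j)) = cis (- (pi / 3) * of_int j) * cis (pi * of_int l)" for l
      by (simp add: cis_mult algebra_simps)
    then have "(\<lambda>l. cis (pi / 3 * of_int (3 * l - j)) * h (of_int (3 * l - j) / lam)) = (\<lambda>l. cis (- (pi / 3) * of_int j) * r j l)"
      by (simp add: r_def mult.assoc)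
    then show "((\<lambda>l. cis (pi / 3 * of_int (3 * l - j)) * h (of_int (3 * l - j) / lam)) has_sum cis (- (pi / 3) * of_int j) * R j) UNIV"
      by (simp only:) (rule has_sum_cmult_right[OF r])
  qed
  then have "(cis (- (pi / 3)) + cis (- (pi * 2 / 3))) * R 1 = 0"
    using has_sum_unique[OF zero] by (fastforce simp: R0 R2 distrib_right)
  moreover have "cis (- (pi / 3)) + cis (- (pi * 2 / 3)) \<noteq> 0"
  proof -
    have "sin (pi / 3) > 0" "sin (pi * 2 / 3) > 0" by (intro sin_gt_zero; simp)+
    then have "Im (cis (- (pi / 3)) + cis (- (pi * 2 / 3))) < 0" by simp
    then show ?thesis by force
  qed
  ultimately have R1: "R 1 = 0" by simp
  have R: "R (int j) = 0" if "j < 3" for j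
  proof -
    from that consider "int j = 0" | "int j = 1" | "int j = 2" by linarith
    then show ?thesis using R0 R1 R2 by cases simp_all
  qed
  interpret gabor_obstruction h mu 0 pi C 3
  proof
    fix j :: nat assume j: "j < 3"
    have "cis (pi * of_int l) * h (0 + mu * of_int l - mu / real 3 * real j) = r (int j) l" for l
    proof -
      have "0 + mu * of_int l - mu / real 3 * real j = of_int (3 * l - int j) / lam"
        by (simp add: mu_def diff_divide_distrib)
      then show ?thesis by (simp only: r_def)
    qed
    then show "(\<Sum>\<^sub>\<infinity>l\<in>(UNIV::int set). cis (pi * of_int l) * h (0 + mu * of_int l - mu / real 3 * real j)) = 0"
      using R[OF j] by (simp only: R_def)
  qed (use h mu in simp_all)
  from not_frame show ?thesis by (simp add: mu_def)
qed

theorem mainTheorem4: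
  fixes n :: nat
  assumes "n \<ge> 3" and "odd n"
  shows "\<exists>l3::real. l3 > sqrt 3 \<and>
           zak l3 (hermite_fun n) (1/6) 0 = 0 \<and>
           (l3 / 3, 1 / l3) \<notin> frame_set (hermite_fun n) \<and>
           (1 / l3, l3 / 3) \<notin> frame_set (hermite_fun n)"
proof -
  obtain lam where lam3: "lam > sqrt 3" and zero: "lattice_sum (hermite_gauss n) lam = 0"
    using hermite_lattice_sum_zero[OF assms] by blast
  have lam: "lam > 0" using lam3 real_sqrt_ge_zero[of 3] by linarith
  define c where "c = hermite_const n powr (-1/2)"
  define h where "h = hermite_fun n"
  have h: "h x = of_real c * of_real (hermite_gauss n x)" for x
    by (simp add: h_def hermite_fun_eq c_def)
  obtain C where "decays (\<lambda>x. complex_of_real (hermite_gauss n x)) C" using poly_gauss_decays by blast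
  then have dec: "decays h (norm (complex_of_real c) * C)"
    unfolding h [abs_def] by (rule decays_mult)
  have cont: "continuous_on UNIV h"
    unfolding h [abs_def] by (intro continuous_intros)
  have odd: "h (- x) = - h x" for x
    using assms by (simp add: h hermite_gauss_uminus)
  have sum0: "((\<lambda>k::int. h (lam / 6 + lam * of_int k)) has_sum 0) UNIV"
  proof -
    obtain D where D: "decays (hermite_gauss n) D" using hermite_gauss_decays by blast
    have "((\<lambda>k::int. of_real c * complex_of_real (hermite_gauss n (lam / 6 + lam * of_int k))) has_sum
        of_real c * of_real (lattice_sum (hermite_gauss n) lam)) UNIV"
      by (intro has_sum_cmult_right lattice_sum_has_sum[OF D lam])
    then show ?thesis by (simp add: h zero)
  qed
  have "zak lam h (1/6) 0 = 0"
  proof -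
    have "(\<lambda>k::int. h (lam * (1/6 + of_int k))) = (\<lambda>k. h (lam / 6 + lam * of_int k))"
      by (intro ext arg_cong[of _ _ h]) (simp add: algebra_simps)
    then show ?thesis using sum0 by (simp add: zak_def infsumI)
  qed
  moreover have "\<not> is_L2_frame (gabor_atom h (lam / 3) (1 / lam))"
    by (rule odd_window_not_frame[OF dec cont odd lam sum0])
  moreover have "\<not> is_L2_frame (gabor_atom h (1 / lam) (lam / 3))"
  proof (rule odd_window_not_frame_dual[OF dec cont odd lam])
    have "((\<lambda>m::int. of_real c * (cis (pi / 3 * of_int m) * of_real (hermite_gauss n (of_int m / lam)))) has_sum of_real c * 0) UNIV"
      by (intro has_sum_cmult_right hermite_poisson_zero[OF lam zero])
    then show "((\<lambda>m::int. cis (pi / 3 * of_int m) * h (of_int m / lam)) has_sum 0) UNIV"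
      by (simp add: h mult_ac)
  qed
  ultimately show ?thesis
    using lam3 by (intro exI[of _ lam]) (simp add: frame_set_def h_def)
qed

end
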